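(* Let $k$ be an infinite field with $\operatorname{char} k \neq 2$ which is not algebraically closed. Let $a,b,c,d\in k$ with $a\in k\setminus k^2$, $b\neq 0$, and at least one of $c,d$ non-zero. Let $L_0=k(t_1,t_2,t_3,t_4)$ be a field extension of $k$ with $\operatorname{trdeg}_k(L_0)=2$ whose generators satisfy \[ t_1^2-at_2^2=b,\qquad t_3^2-at_4^2=2ct_1+d. \] Assume that $b=\beta^2$ with $\beta\in k\setminus\{0\}$. Then the following statements are equivalent: (i) $L_0$ is $k$-rational; (ii) $L_0$ is stably $k$-rational; (iii) $L_0$ is $k$-unirational; (iv) either $-2c\beta+d\neq 0$ and $(a,-2c\beta+d)_{2,k(\sqrt{d^2-4bc^2})}=0$, or $-2c\beta+d=0$ and $(a,2d)_{2,k}=0$.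
   Context: A finitely generated field extension $L/k$ is $k$-rational if it is purely transcendental over $k$; stably $k$-rational if $L(y_1,\dots,y_m)$ is $k$-rational for some elements $y_1,\dots,y_m$ algebraically independent over $L$; $k$-unirational if $L$ is $k$-isomorphic to a subfield of a $k$-rational field. For a field $F$ with $\operatorname{char}F\neq 2$ and non-zero $u,v\in F$, $(u,v)_{2,F}$ denotes the class in the Brauer group $\mathrm{Br}(F)$ of the quaternion algebra generated over $F$ by $U,V$ with $U^2=u$, $V^2=v$, $UV=-VU$ (Hilbert symbol); $(u,v)_{2,F}=0$ if and only if there exist $x,y\in F$ with $ux^2+vy^2=1$. *)

theory Defs
  imports "HOL-Library.Poly_Mapping" "HOL-Library.Extended_Nat"
    "HOL-Computational_Algebra.Fraction_Field"
    "HOL-Computational_Algebra.Polynomial"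
    "HOL-Algebra.Algebraic_Closure_Type"
begin

definition is_subfield :: "'f::field set \<Rightarrow> bool" where
  "is_subfield F \<longleftrightarrow> 0 \<in> F \<and> 1 \<in> F \<and>
     (\<forall>x\<in>F. \<forall>y\<in>F. x + y \<in> F \<and> x * y \<in> F) \<and>
     (\<forall>x\<in>F. - x \<in> F \<and> inverse x \<in> F)"

definition gen_field :: "'f::field set \<Rightarrow> 'f set \<Rightarrow> 'f set" where
  "gen_field K S = \<Inter> {F. is_subfield F \<and> K \<union> S \<subseteq> F}"

text \<open>Multivariate polynomials whose variables are indexed by field elements
  themselves; mpeval substitutes every variable s by the element s.\<close>
definition mpeval :: "(('f::field \<Rightarrow>\<^sub>0 nat) \<Rightarrow>\<^sub>0 'f) \<Rightarrow> 'f" where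
  "mpeval p = (\<Sum>m\<in>Poly_Mapping.keys p. Poly_Mapping.lookup p m * (\<Prod>s\<in>Poly_Mapping.keys m. (s::'f) ^ Poly_Mapping.lookup (m::'f \<Rightarrow>\<^sub>0 nat) s))"

definition alg_indep :: "'f::field set \<Rightarrow> 'f set \<Rightarrow> bool" where
  "alg_indep K S \<longleftrightarrow> finite S \<and>
     (\<forall>p :: ('f \<Rightarrow>\<^sub>0 nat) \<Rightarrow>\<^sub>0 'f.
        (\<forall>m. Poly_Mapping.lookup p m \<in> K) \<longrightarrow> (\<forall>m\<in>Poly_Mapping.keys p. Poly_Mapping.keys m \<subseteq> S) \<longrightarrow>
        mpeval p = 0 \<longrightarrow> p = 0)"

definition trdeg :: "'f::field set \<Rightarrow> 'f set \<Rightarrow> enat" where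
  "trdeg K L = (SUP S\<in>{S. S \<subseteq> L \<and> alg_indep K S}. enat (card S))"

definition rational_over :: "'f::field set \<Rightarrow> 'f set \<Rightarrow> bool" where
  "rational_over K L \<longleftrightarrow> (\<exists>S. S \<subseteq> L \<and> alg_indep K S \<and> L = gen_field K S)"

text \<open>Universe for auxiliary extensions: the field of rational functions in
  countably many indeterminates over the ambient field.\<close>
type_synonym 'a ratfun = "((nat \<Rightarrow>\<^sub>0 nat) \<Rightarrow>\<^sub>0 'a) fract"

definition rf_const :: "'a::field \<Rightarrow> 'a ratfun" where
  "rf_const x = Fract (Poly_Mapping.single 0 x) 1"

definition embedding_over ::
    "('f::field \<Rightarrow> 'g::field) \<Rightarrow> 'f set \<Rightarrow> 'f set \<Rightarrow> ('f \<Rightarrow> 'g) \<Rightarrow> bool" where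
  "embedding_over \<iota> K L f \<longleftrightarrow>
     (\<forall>x\<in>L. \<forall>y\<in>L. f (x + y) = f x + f y \<and> f (x * y) = f x * f y) \<and>
     f 1 = 1 \<and> inj_on f L \<and> (\<forall>x\<in>K. f x = \<iota> x)"

definition stably_rational_over :: "'a::field set \<Rightarrow> 'a set \<Rightarrow> bool" where
  "stably_rational_over K L \<longleftrightarrow>
     (\<exists>(f :: 'a \<Rightarrow> 'a ratfun) Y. embedding_over rf_const K L f \<and>
        alg_indep (f ` L) Y \<and> rational_over (rf_const ` K) (gen_field (f ` L) Y))"

definition unirational_over :: "'a::field set \<Rightarrow> 'a set \<Rightarrow> bool" where
  "unirational_over K L \<longleftrightarrow>
     (\<exists>(f :: 'a \<Rightarrow> 'a ratfun) R. is_subfield R \<and> rf_const ` K \<subseteq> R \<and>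
        rational_over (rf_const ` K) R \<and> embedding_over rf_const K L f \<and> f ` L \<subseteq> R)"

definition sqrt_ext :: "'a::field alg_closure set \<Rightarrow> 'a alg_closure \<Rightarrow> 'a alg_closure set" where
  "sqrt_ext K D = gen_field K {SOME r. r ^ 2 = D}"

text \<open>(u,v)_{2,F} = 0, via the characterisation given in the paper.\<close>
definition hilbert_trivial :: "'f::field set \<Rightarrow> 'f \<Rightarrow> 'f \<Rightarrow> bool" where
  "hilbert_trivial F u v \<longleftrightarrow> (\<exists>x\<in>F. \<exists>y\<in>F. u * x ^ 2 + v * y ^ 2 = 1)"

definition alg_closed_subfield :: "'f::field set \<Rightarrow> bool" where
  "alg_closed_subfield K \<longleftrightarrow>
     (\<forall>p :: 'f poly. (\<forall>i. coeff p i \<in> K) \<longrightarrow> degree p > 0 \<longrightarrow> (\<exists>x\<in>K. poly p x = 0))"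

end

theory Submission
  imports Defs
begin

text \<open>With $s = t_2 / (t_1 + \beta)$ and $e = d - 2c\beta$, $e' = d + 2c\beta$, the field $L_0$ becomes the
  function field $k(s, u, v)$ of the quadric $u^2 - a v^2 = e' - a e s^2$.
  Everything is tied to the condition that $e' w^2 - a e s^2$ and $u^2 - a v^2$ represent a common
  non-zero value over $k$. Over $L_0$ this is the equation itself; if $L_0$ embeds into a
  rational field, the condition descends to $k$ by clearing denominators and specialising one variable
  at a time. Conversely, multiplying by a common value
  turns the equation into $(U - A)(U + A) = a (V^2 - e e' C^2)$, and $V / (U + A)$, $C / (U + A)$
  generate $L_0$; they are algebraically independent because the transcendence degree is 2.
  Finally the condition is equivalent to the vanishing of the Hilbert symbol over $k(\sqrt{e e'})$, the
  quadratic extension given by the discriminant of the quadric.\<close>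

section \<open>Subfields and algebraic elements\<close>

text \<open>Behind the common-value condition stands the quaternary form <e', -a e, a, -1>, of
  determinant e e' up to squares. If e and e' are non-zero, then over k(sqrt(e e')) they agree up to
  a square, the form becomes e<1, -a> - <1, -a>, and it is isotropic exactly when e is a norm, that
  is, when (a, e) vanishes. The arithmetic core is thus the descent of isotropy from the
  discriminant extension to k. Asking for a non-zero common value instead of a non-trivial zero has
  two benefits. The rationality argument then also covers e = 0 and e' = 0, where the form
  degenerates, without a case distinction. Algebraic independence is defined by multivariate
  polynomials whose variables are field elements, which makes it awkward to specialise or to
  transport to another field. It is therefore traded for towers of simple transcendental extensions,
  where only univariate polynomials occur.\<close>

lemma is_subfieldD:
  assumes "is_subfield F"
  shows "0 \<in> F" "1 \<in> F" "x \<in> F \<Longrightarrow> y \<in> F \<Longrightarrow> x + y \<in> F" "x \<in> F \<Longrightarrow> y \<in> F \<Longrightarrow> x * y \<in> F"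
    "x \<in> F \<Longrightarrow> - x \<in> F" "x \<in> F \<Longrightarrow> inverse x \<in> F"
  using assms by (auto simp: is_subfield_def)

lemma is_subfield_diff: "is_subfield F \<Longrightarrow> x \<in> F \<Longrightarrow> y \<in> F \<Longrightarrow> x - y \<in> F"
  using is_subfieldD(3,5)[of F] by (metis diff_conv_add_uminus)

lemma is_subfield_divide: "is_subfield F \<Longrightarrow> x \<in> F \<Longrightarrow> y \<in> F \<Longrightarrow> x / y \<in> F"
  using is_subfieldD(4,6)[of F] by (metis divide_inverse)

lemma is_subfield_power: "is_subfield F \<Longrightarrow> x \<in> F \<Longrightarrow> x ^ n \<in> F"
  by (induction n) (auto intro: is_subfieldD)

lemma is_subfield_sum: "is_subfield F \<Longrightarrow> (\<And>i. i \<in> I \<Longrightarrow> f i \<in> F) \<Longrightarrow> sum f I \<in> F"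
  by (induction I rule: infinite_finite_induct) (auto intro: is_subfieldD)

lemma is_subfield_prod: "is_subfield F \<Longrightarrow> (\<And>i. i \<in> I \<Longrightarrow> f i \<in> F) \<Longrightarrow> prod f I \<in> F"
  by (induction I rule: infinite_finite_induct) (auto intro: is_subfieldD)

lemma is_subfield_numeral: "is_subfield F \<Longrightarrow> numeral n \<in> F"
proof -
  assume F: "is_subfield F"
  have "of_nat m \<in> F" for m
    by (induction m) (auto intro: is_subfieldD[OF F])
  from this[of "numeral n"] show ?thesis by simp
qed

text \<open>Later proofs refer to members by position: 7 is the difference and 8 the
  quotient.\<close>

lemmas is_subfield_closed =
  is_subfieldD is_subfield_diff is_subfield_divide is_subfield_power is_subfield_numeral

text \<open>Inverses need checking only for non-zero elements because
  \<open>inverse 0 = 0\<close>.\<close>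

lemma is_subfieldI:
  assumes "0 \<in> F" "1 \<in> F" "\<And>x y. x \<in> F \<Longrightarrow> y \<in> F \<Longrightarrow> x + y \<in> F"
    "\<And>x y. x \<in> F \<Longrightarrow> y \<in> F \<Longrightarrow> x * y \<in> F" "\<And>x. x \<in> F \<Longrightarrow> - x \<in> F"
    "\<And>x. x \<in> F \<Longrightarrow> x \<noteq> 0 \<Longrightarrow> inverse x \<in> F"
  shows "is_subfield F"
  using assms unfolding is_subfield_def by (metis inverse_zero)

lemma is_subfield_gen_field: "is_subfield (gen_field K S)"
  by (auto simp: is_subfield_def gen_field_def)

lemma gen_field_base: "K \<subseteq> gen_field K S"
  and gen_field_gens: "S \<subseteq> gen_field K S"
  by (auto simp: gen_field_def)

lemma gen_field_least: "is_subfield F \<Longrightarrow> K \<subseteq> F \<Longrightarrow> S \<subseteq> F \<Longrightarrow> gen_field K S \<subseteq> F"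
  by (auto simp: gen_field_def)

lemma gen_field_empty: "is_subfield K \<Longrightarrow> gen_field K {} = K"
  using gen_field_base[of K "{}"] gen_field_least[of K K "{}"] by auto

lemma gen_field_gen_field: "gen_field (gen_field K S) T = gen_field K (S \<union> T)"
proof
  show "gen_field (gen_field K S) T \<subseteq> gen_field K (S \<union> T)"
    using gen_field_base[of K "S \<union> T"] gen_field_gens[of "S \<union> T" K]
    by (intro gen_field_least is_subfield_gen_field) auto
  show "gen_field K (S \<union> T) \<subseteq> gen_field (gen_field K S) T"
    using gen_field_base[of "gen_field K S" T] gen_field_gens[of T "gen_field K S"]
      gen_field_base[of K S] gen_field_gens[of S K]
    by (intro gen_field_least is_subfield_gen_field) auto
qed

lemma gen_field_insert: "gen_field K (insert x S) = gen_field (gen_field K S) {x}"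
  by (simp add: gen_field_gen_field)

section \<open>Univariate polynomials over a subfield and transcendental elements\<close>

definition polys :: "'a::field set \<Rightarrow> 'a poly set" where
  "polys F = {p. \<forall>i. coeff p i \<in> F}"

lemma polys_closed:
  assumes F: "is_subfield F"
  shows "0 \<in> polys F" "1 \<in> polys F" "p \<in> polys F \<Longrightarrow> q \<in> polys F \<Longrightarrow> p + q \<in> polys F"
    "p \<in> polys F \<Longrightarrow> q \<in> polys F \<Longrightarrow> p - q \<in> polys F"
    "p \<in> polys F \<Longrightarrow> q \<in> polys F \<Longrightarrow> p * q \<in> polys F"
    "p \<in> polys F \<Longrightarrow> - p \<in> polys F" "x \<in> F \<Longrightarrow> [:x:] \<in> polys F"
    "x \<in> F \<Longrightarrow> monom x n \<in> polys F" "x \<in> F \<Longrightarrow> p \<in> polys F \<Longrightarrow> smult x p \<in> polys F"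
    "p \<in> polys F \<Longrightarrow> p ^ n \<in> polys F"
proof -
  show "0 \<in> polys F" and one: "1 \<in> polys F" and
    "p \<in> polys F \<Longrightarrow> q \<in> polys F \<Longrightarrow> p + q \<in> polys F"
    "p \<in> polys F \<Longrightarrow> q \<in> polys F \<Longrightarrow> p - q \<in> polys F"
    "p \<in> polys F \<Longrightarrow> - p \<in> polys F" "x \<in> F \<Longrightarrow> [:x:] \<in> polys F"
    "x \<in> F \<Longrightarrow> monom x n \<in> polys F" "x \<in> F \<Longrightarrow> p \<in> polys F \<Longrightarrow> smult x p \<in> polys F"
    by (auto simp: polys_def coeff_pCons split: nat.splits intro: is_subfield_closed[OF F])
  show mult: "p \<in> polys F \<Longrightarrow> q \<in> polys F \<Longrightarrow> p * q \<in> polys F" for p q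
    by (auto simp: polys_def coeff_mult intro!: is_subfield_sum[OF F] is_subfieldD[OF F])
  show "p \<in> polys F \<Longrightarrow> p ^ n \<in> polys F"
    by (induction n) (auto intro: mult one)
qed

lemma polys_sum: "is_subfield F \<Longrightarrow> (\<And>i. i \<in> I \<Longrightarrow> f i \<in> polys F) \<Longrightarrow> sum f I \<in> polys F"
  by (induction I rule: infinite_finite_induct) (auto intro: polys_closed)

lemma poly_in_subfield: "is_subfield F \<Longrightarrow> p \<in> polys F \<Longrightarrow> x \<in> F \<Longrightarrow> poly p x \<in> F"
  by (auto simp: poly_altdef polys_def intro!: is_subfield_sum is_subfieldD is_subfield_power)

definition transc :: "'a::field set \<Rightarrow> 'a \<Rightarrow> bool" where
  "transc F x \<longleftrightarrow> (\<forall>p\<in>polys F. poly p x = 0 \<longrightarrow> p = 0)"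

lemma transcD: "transc F x \<Longrightarrow> p \<in> polys F \<Longrightarrow> poly p x = 0 \<Longrightarrow> p = 0"
  by (auto simp: transc_def)

lemma transc_mono: "transc F x \<Longrightarrow> E \<subseteq> F \<Longrightarrow> transc E x"
  by (auto simp: transc_def polys_def)

lemma not_transc_self:
  assumes "is_subfield F" "x \<in> F"
  shows "\<not> transc F x"
proof -
  have "[:- x, 1:] \<in> polys F"
    using assms by (auto simp: polys_def coeff_pCons split: nat.splits intro: is_subfieldD)
  then show ?thesis
    by (force simp: transc_def)
qed

lemma gen_field_rational_function:
  assumes F: "is_subfield F" and y: "y \<in> gen_field F {x}"
  shows "\<exists>p\<in>polys F. \<exists>q\<in>polys F. poly q x \<noteq> 0 \<and> y = poly p x / poly q x"
proof -
  let ?Q = "{y. \<exists>p\<in>polys F. \<exists>q\<in>polys F. poly q x \<noteq> 0 \<and> y = poly p x / poly q x}"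
  have Q: "z \<in> ?Q" if "p \<in> polys F" "q \<in> polys F" "poly q x \<noteq> 0" "z = poly p x / poly q x" for p q z
    using that by blast
  have "gen_field F {x} \<subseteq> ?Q"
  proof (intro gen_field_least is_subfieldI)
    show "F \<subseteq> ?Q"
    proof
      fix z assume "z \<in> F"
      then show "z \<in> ?Q"
        by (intro Q[of "[:z:]" 1]) (auto intro: polys_closed[OF F])
    qed
    show "{x} \<subseteq> ?Q"
      using Q[of "monom 1 1" 1 x] by (auto intro: polys_closed[OF F] is_subfieldD[OF F] simp: poly_monom)
    show "0 \<in> ?Q" "1 \<in> ?Q"
      using Q[of 0 1 0] Q[of 1 1 1] by (auto intro: polys_closed[OF F])
  next
    fix y z assume "y \<in> ?Q" "z \<in> ?Q"
    then obtain p q p' q' where *: "p \<in> polys F" "q \<in> polys F" "poly q x \<noteq> 0" "y = poly p x / poly q x"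
      "p' \<in> polys F" "q' \<in> polys F" "poly q' x \<noteq> 0" "z = poly p' x / poly q' x" by auto
    show "y + z \<in> ?Q"
      using * by (intro Q[of "p * q' + p' * q" "q * q'"]) (auto intro!: polys_closed[OF F] simp: add_frac_eq)
    show "y * z \<in> ?Q"
      using * by (intro Q[of "p * p'" "q * q'"]) (auto intro!: polys_closed[OF F])
  next
    fix y assume "y \<in> ?Q"
    then obtain p q where *: "p \<in> polys F" "q \<in> polys F" "poly q x \<noteq> 0" "y = poly p x / poly q x"
      by auto
    show "- y \<in> ?Q"
      using * by (intro Q[of "- p" q]) (auto intro!: polys_closed[OF F])
    show "inverse y \<in> ?Q" if "y \<noteq> 0"
      using * that by (intro Q[of q p]) (auto intro!: polys_closed[OF F])
  qed
  with y show ?thesis by auto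
qed

text \<open>For a subfield F this is the algebraic closure of F relative to the ambient
  field.\<close>

definition acl :: "'a::field set \<Rightarrow> 'a set" where
  "acl F = {x. \<not> transc F x}"

lemma acl_mono: "E \<subseteq> F \<Longrightarrow> acl E \<subseteq> acl F"
  by (auto simp: acl_def dest: transc_mono)

lemma acl_base: "is_subfield F \<Longrightarrow> F \<subseteq> acl F"
  by (auto simp: acl_def not_transc_self)

section \<open>The relative algebraic closure, by translation to HOL-Algebra\<close>

context
  fixes R :: "'a::field ring"
  defines "R \<equiv> ring_of_type_algebra"
begin

interpretation R: field R
  unfolding R_def by rule

lemma R_simps: "carrier R = UNIV" "x \<otimes>\<^bsub>R\<^esub> y = x * y" "x \<oplus>\<^bsub>R\<^esub> y = x + y"
    "\<one>\<^bsub>R\<^esub> = 1" "\<zero>\<^bsub>R\<^esub> = 0"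
  by (auto simp: R_def ring_of_type_algebra_def)

lemma R_pow: "x [^]\<^bsub>R\<^esub> (n::nat) = x ^ n"
  by (induction n) (auto simp: R_simps mult.commute)

lemma R_uminus: "\<ominus>\<^bsub>R\<^esub> x = - x"
  by (rule R.minus_equality) (auto simp: R_simps)

lemma R_inv: "x \<noteq> 0 \<Longrightarrow> inv\<^bsub>R\<^esub> x = inverse x"
  using R.comm_inv_char[of x "inverse x"] by (auto simp: R_simps)

lemma subfield_R_iff: "subfield F R \<longleftrightarrow> is_subfield F"
proof
  assume F: "subfield F R"
  note sr = subfieldE(1)[OF F]
  show "is_subfield F"
    using subringE[OF sr] R.subfield_m_inv(1)[OF F]
    by (intro is_subfieldI) (auto simp: R_simps R_uminus R_inv)
next
  assume "is_subfield F"
  then show "subfield F R"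
    by (intro R.subfieldI' R.subringI)
      (auto simp: R_simps R_uminus R_inv intro: is_subfieldD)
qed

text \<open>List polynomials carry the leading coefficient at the head, whereas \<open>Poly\<close>
  expects the constant term there; hence the reversal.\<close>

lemma R_eval: "R.eval p x = poly (Poly (rev p)) x"
  by (induction p) (auto simp: R_simps R_pow Poly_append poly_monom Poly_snoc)

lemma R_algebraic_iff:
  fixes F :: "'a set"
  assumes F: "is_subfield F"
  shows "(R.algebraic over F) x \<longleftrightarrow> x \<in> acl F"
proof
  assume "(R.algebraic over F) x"
  then obtain p where p: "p \<in> carrier (F [X]\<^bsub>R\<^esub>)" "p \<noteq> []" "R.eval p x = \<zero>\<^bsub>R\<^esub>"
    using R.algebraicE[of F x] F subfieldE(1)[of F R] by (auto simp: subfield_R_iff R_simps)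
  then have s: "set p \<subseteq> F" "hd p \<noteq> 0"
    by (auto simp: univ_poly_def polynomial_def R_simps)
  have "Poly (rev p) \<in> polys F"
    using s is_subfieldD(1)[OF F]
    by (auto simp: polys_def nth_default_def coeff_Poly_eq) (metis length_rev nth_mem set_rev subsetD)
  moreover have "coeff (Poly (rev p)) (length p - 1) = hd p"
    using p(2) by (cases p) (auto simp: coeff_Poly_eq nth_default_def nth_append)
  ultimately show "x \<in> acl F"
    using s p(3) unfolding acl_def transc_def R_eval R_simps
    by (metis (mono_tags, lifting) coeff_0 mem_Collect_eq)
next
  assume "x \<in> acl F"
  then obtain p where p: "p \<in> polys F" "p \<noteq> 0" "poly p x = 0"
    by (auto simp: acl_def transc_def)
  show "(R.algebraic over F) x"
  proof (rule R.algebraicI[of "rev (coeffs p)"])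
    show "rev (coeffs p) \<in> carrier (F [X]\<^bsub>R\<^esub>)"
      using p by (auto simp: univ_poly_def polynomial_def R_simps hd_rev last_coeffs_eq_coeff_degree
          polys_def coeffs_def)
  qed (use p in \<open>auto simp: R_eval R_simps\<close>)
qed

lemma is_subfield_acl:
  fixes F :: "'a set"
  assumes "is_subfield F"
  shows "is_subfield (acl F)"
  using R.subfield_of_algebraics[of F] assms by (simp add: subfield_R_iff R_algebraic_iff R_simps)

text \<open>The coefficients of an equation for x generate a finite extension E of F, and E(x) is
  finite over E. By the tower law E(x) is finite over F, so x is algebraic over F.\<close>

lemma acl_acl:
  fixes F :: "'a set"
  assumes F: "is_subfield F"
  shows "acl (acl F) \<subseteq> acl F"
proof
  fix x assume "x \<in> acl (acl F)"
  then have "(R.algebraic over acl F) x"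
    using R_algebraic_iff is_subfield_acl[OF F] by blast
  then obtain p where p: "p \<in> carrier (acl F [X]\<^bsub>R\<^esub>)" "p \<noteq> []" "R.eval p x = \<zero>\<^bsub>R\<^esub>"
    using R.algebraicE[of "acl F" x] is_subfield_acl[OF F] subfieldE(1)[of "acl F" R]
    by (auto simp: subfield_R_iff R_simps)
  define E where "E = R.finite_extension F p"
  have FR: "subfield F R" using F by (simp add: subfield_R_iff)
  have sp: "set p \<subseteq> acl F"
    using p by (auto simp: univ_poly_def polynomial_def)
  have E: "subfield E R" "R.finite_dimension F E"
    unfolding E_def using sp
    by (auto intro!: R.finite_extension_is_subfield[OF FR] R.finite_extension_finite_dimension(1)[OF FR]
        simp: R_simps R_algebraic_iff[OF F] simp del: R.finite_extension.simps)
  have "set p \<subseteq> E"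
    unfolding E_def using R.finite_extension_mem[of F p] subfieldE(1)[OF FR] by (simp add: R_simps)
  then have "p \<in> carrier (E [X]\<^bsub>R\<^esub>)"
    using p by (auto simp: univ_poly_def polynomial_def)
  then have alg: "(R.algebraic over E) x"
    using p by (intro R.algebraicI)
  have "R.finite_dimension E (R.simple_extension E x)"
    using R.finite_dimension_simple_extension[OF E(1), of x] alg by (simp add: R_simps)
  then have "R.finite_dimension F (R.simple_extension E x)"
    using R.telescopic_base_dim(1)[OF FR E(1) E(2)] by blast
  then have "(R.algebraic over F) x"
    using R.finite_dimension_imp_algebraic[OF FR _ _ , of "R.simple_extension E x" x]
      R.simple_extension_mem[of E x] R.simple_extension_is_subring[of E x] subfieldE(1)[OF E(1)]
    by (simp add: R_simps)
  then show "x \<in> acl F"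
    using F by (simp add: R_algebraic_iff)
qed

end

section \<open>Algebraic independence through univariate transcendence\<close>

definition mon_eval :: "('a::field \<Rightarrow>\<^sub>0 nat) \<Rightarrow> 'a" where
  "mon_eval m = (\<Prod>s\<in>Poly_Mapping.keys m. s ^ Poly_Mapping.lookup m s)"

lemma mon_eval_superset:
  assumes "finite A" "Poly_Mapping.keys m \<subseteq> A"
  shows "mon_eval m = (\<Prod>s\<in>A. s ^ Poly_Mapping.lookup m s)"
  unfolding mon_eval_def using assms by (intro prod.mono_neutral_left) (auto simp: in_keys_iff)

lemma mon_eval_add: "mon_eval (m + n) = mon_eval m * mon_eval n"
proof -
  let ?A = "Poly_Mapping.keys m \<union> Poly_Mapping.keys n"
  have "mon_eval (m + n) = (\<Prod>s\<in>?A. s ^ Poly_Mapping.lookup (m + n) s)"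
    by (intro mon_eval_superset) (auto dest!: subsetD[OF keys_add])
  also have "\<dots> = mon_eval m * mon_eval n"
    by (simp add: mon_eval_superset[of ?A m] mon_eval_superset[of ?A n] lookup_add power_add prod.distrib)
  finally show ?thesis .
qed

lemma mon_eval_0 [simp]: "mon_eval 0 = 1"
  by (simp add: mon_eval_def)

lemma mon_eval_single: "mon_eval (Poly_Mapping.single x n) = x ^ n"
  by (cases "n = 0") (auto simp: mon_eval_def)

lemma mpeval_superset:
  assumes "finite M" "Poly_Mapping.keys p \<subseteq> M"
  shows "mpeval p = (\<Sum>m\<in>M. Poly_Mapping.lookup p m * mon_eval m)"
  unfolding mpeval_def mon_eval_def[symmetric] using assms
  by (intro sum.mono_neutral_left) (auto simp: in_keys_iff)

lemma lookup_Abs_if: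
  assumes "finite M"
  shows "Poly_Mapping.lookup (Abs_poly_mapping (\<lambda>m. if m \<in> M then c m else 0)) = (\<lambda>m. if m \<in> M then c m else 0)"
proof -
  have "finite {m. (if m \<in> M then c m else 0) \<noteq> 0}"
    by (rule finite_subset[OF _ assms]) auto
  then show ?thesis by simp
qed

text \<open>Here M may be any finite set of monomials and coefficients may vanish, so later
  arguments handle plain finite sums instead of building formal polynomials. Membership of 0 in K
  allows the coefficients outside M to be filled up with 0.\<close>

lemma alg_indep_iff_mon:
  assumes "0 \<in> K"
  shows "alg_indep K S \<longleftrightarrow> finite S \<and>
    (\<forall>M c. finite M \<longrightarrow> (\<forall>m\<in>M. Poly_Mapping.keys m \<subseteq> S \<and> c m \<in> K) \<longrightarrow>
       (\<Sum>m\<in>M. c m * mon_eval m) = 0 \<longrightarrow> (\<forall>m\<in>M. c m = 0))" (is "_ \<longleftrightarrow> _ \<and> ?ind")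
proof -
  have "(\<forall>p :: ('a \<Rightarrow>\<^sub>0 nat) \<Rightarrow>\<^sub>0 'a.
        (\<forall>m. Poly_Mapping.lookup p m \<in> K) \<longrightarrow> (\<forall>m\<in>Poly_Mapping.keys p. Poly_Mapping.keys m \<subseteq> S) \<longrightarrow>
        mpeval p = 0 \<longrightarrow> p = 0) \<longleftrightarrow> ?ind" (is "?alg \<longleftrightarrow> _")
  proof
    assume L: ?alg
    show ?ind
    proof (intro allI impI)
      fix M c
      assume M: "finite M" "\<forall>m\<in>M. Poly_Mapping.keys m \<subseteq> S \<and> c m \<in> K" "(\<Sum>m\<in>M. c m * mon_eval m) = 0"
      define p where "p = Abs_poly_mapping (\<lambda>m. if m \<in> M then c m else 0)"
      have lk: "Poly_Mapping.lookup p = (\<lambda>m. if m \<in> M then c m else 0)"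
        unfolding p_def by (rule lookup_Abs_if[OF M(1)])
      have keys: "Poly_Mapping.keys p \<subseteq> M"
        by (auto simp: in_keys_iff lk split: if_splits)
      have "mpeval p = (\<Sum>m\<in>M. c m * mon_eval m)"
        unfolding mpeval_superset[OF M(1) keys] by (intro sum.cong refl) (simp add: lk)
      then have "mpeval p = 0" by (simp only: M(3))
      moreover have "Poly_Mapping.lookup p m \<in> K" for m
        using M(2) assms by (cases "m \<in> M") (simp_all add: lk)
      moreover have "Poly_Mapping.keys m \<subseteq> S" if "m \<in> Poly_Mapping.keys p" for m
        using M(2) keys that by auto
      ultimately have "p = 0"
        by (intro mp[OF mp[OF mp[OF spec[OF L]]]] allI ballI)
      show "\<forall>m\<in>M. c m = 0"
      proof
        fix m assume "m \<in> M"
        then show "c m = 0"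
          using fun_cong[OF lk, of m] \<open>p = 0\<close> by simp
      qed
    qed
  next
    assume R: ?ind
    show ?alg
    proof (intro allI impI)
      fix p :: "('a \<Rightarrow>\<^sub>0 nat) \<Rightarrow>\<^sub>0 'a"
      assume "\<forall>m. Poly_Mapping.lookup p m \<in> K" "\<forall>m\<in>Poly_Mapping.keys p. Poly_Mapping.keys m \<subseteq> S" "mpeval p = 0"
      then have "\<forall>m\<in>Poly_Mapping.keys p. Poly_Mapping.lookup p m = 0"
        unfolding mpeval_superset[OF finite_keys order_refl]
        by (intro mp[OF mp[OF mp[OF spec[OF spec[OF R]]]]] finite_keys ballI conjI) blast+
      then have "Poly_Mapping.lookup p m = 0" for m
        by (cases "m \<in> Poly_Mapping.keys p") (simp_all add: in_keys_iff)
      then show "p = 0"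
        by (intro poly_mapping_eqI) simp
    qed
  qed
  then show ?thesis by (simp only: alg_indep_def)
qed

lemma alg_indepD:
  assumes "0 \<in> K" "alg_indep K S" "finite M" "\<And>m. m \<in> M \<Longrightarrow> Poly_Mapping.keys m \<subseteq> S"
    "\<And>m. m \<in> M \<Longrightarrow> c m \<in> K" "(\<Sum>m\<in>M. c m * mon_eval m) = 0" "m \<in> M"
  shows "c m = 0"
proof -
  have "finite M \<longrightarrow> (\<forall>m\<in>M. Poly_Mapping.keys m \<subseteq> S \<and> c m \<in> K) \<longrightarrow>
       (\<Sum>m\<in>M. c m * mon_eval m) = 0 \<longrightarrow> (\<forall>m\<in>M. c m = 0)"
    by (rule spec[OF spec[OF conjunct2[OF iffD1[OF alg_indep_iff_mon[OF assms(1)] assms(2)]]], of _ c])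
  then show ?thesis using assms(3-) by simp
qed

text \<open>Allows the monomials to be named by an index set, such as pairs of an x-exponent and a
  monomial in the other variables.\<close>

lemma alg_indep_family:
  assumes "0 \<in> K" "alg_indep K S" "finite I" "inj_on \<mu> I"
    "\<And>i. i \<in> I \<Longrightarrow> Poly_Mapping.keys (\<mu> i) \<subseteq> S" "\<And>i. i \<in> I \<Longrightarrow> c i \<in> K"
    "(\<Sum>i\<in>I. c i * mon_eval (\<mu> i)) = 0" "i \<in> I"
  shows "c i = 0"
proof -
  define c' where "c' m = c (the_inv_into I \<mu> m)" for m
  have c': "c' (\<mu> i) = c i" if "i \<in> I" for i
    unfolding c'_def by (subst the_inv_into_f_f[OF assms(4) that]) (rule refl)
  have "c' (\<mu> i) = 0"
  proof (rule alg_indepD[OF assms(1,2)])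
    have "(\<Sum>m\<in>\<mu> ` I. c' m * mon_eval m) = (\<Sum>i\<in>I. c' (\<mu> i) * mon_eval (\<mu> i))"
      by (rule sum.reindex_cong[OF assms(4)]) auto
    also have "\<dots> = (\<Sum>i\<in>I. c i * mon_eval (\<mu> i))"
      by (intro sum.cong refl) (simp only: c')
    finally show "(\<Sum>m\<in>\<mu> ` I. c' m * mon_eval m) = 0"
      by (simp only: assms(7))
    fix m assume "m \<in> \<mu> ` I"
    then obtain j where j: "j \<in> I" "m = \<mu> j" by (rule imageE)
    show "c' m \<in> K" unfolding j(2) c'[OF j(1)] by (rule assms(6)[OF j(1)])
    show "Poly_Mapping.keys m \<subseteq> S" unfolding j(2) by (rule assms(5)[OF j(1)])
  qed (use assms(3,8) in \<open>blast+\<close>)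
  then show ?thesis by (simp only: c'[OF assms(8)])
qed

lemma alg_indep_finite: "alg_indep K S \<Longrightarrow> finite S"
  by (simp add: alg_indep_def)

lemma alg_indep_subset: "alg_indep K S \<Longrightarrow> T \<subseteq> S \<Longrightarrow> alg_indep K T"
  unfolding alg_indep_def by (meson finite_subset subset_trans)

lemma alg_indep_empty:
  assumes "0 \<in> K"
  shows "alg_indep K {}"
  unfolding alg_indep_iff_mon[OF assms]
proof (intro conjI allI impI ballI finite.emptyI)
  fix M :: "('a \<Rightarrow>\<^sub>0 nat) set" and c :: "('a \<Rightarrow>\<^sub>0 nat) \<Rightarrow> 'a" and m
  assume M: "finite M" "\<forall>m\<in>M. Poly_Mapping.keys m \<subseteq> {} \<and> c m \<in> K" "(\<Sum>m\<in>M. c m * mon_eval m) = 0" "m \<in> M"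
  then have "M = {0}" by auto
  with M show "c m = 0" by simp
qed

section \<open>The ring K[S] inside the ambient field, and its fractions\<close>

definition mpolys :: "'a::field set \<Rightarrow> 'a set \<Rightarrow> 'a set" where
  "mpolys K S = {\<Sum>m\<in>M. c m * mon_eval m | M c. finite M \<and> (\<forall>m\<in>M. Poly_Mapping.keys m \<subseteq> S \<and> c m \<in> K)}"

text \<open>Indices with the same monomial are merged by adding their coefficients over each fibre
  of \<mu>. Since \<mu> need not be injective, sums and products of elements can be fed in without
  collecting terms.\<close>

lemma mpolys_family:
  assumes K: "is_subfield K" and "finite I"
    and "\<And>i. i \<in> I \<Longrightarrow> Poly_Mapping.keys (\<mu> i) \<subseteq> S" "\<And>i. i \<in> I \<Longrightarrow> c i \<in> K"
  shows "(\<Sum>i\<in>I. c i * mon_eval (\<mu> i)) \<in> mpolys K S"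
proof -
  have "(\<Sum>i\<in>I. c i * mon_eval (\<mu> i)) = (\<Sum>m\<in>\<mu> ` I. \<Sum>i\<in>{i\<in>I. \<mu> i = m}. c i * mon_eval (\<mu> i))"
    using assms(2) by (rule sum.image_gen)
  also have "\<dots> = (\<Sum>m\<in>\<mu> ` I. (\<Sum>i\<in>{i\<in>I. \<mu> i = m}. c i) * mon_eval m)"
    by (intro sum.cong) (auto simp: sum_distrib_right)
  finally show ?thesis
    unfolding mpolys_def using assms(2-)
    by (intro CollectI exI[of _ "\<mu> ` I"] exI[of _ "\<lambda>m. \<Sum>i\<in>{i\<in>I. \<mu> i = m}. c i"])
      (auto intro!: is_subfield_sum[OF K])
qed

lemma mpolysE:
  assumes "y \<in> mpolys K S"
  obtains M c where "finite M" "\<forall>m\<in>M. Poly_Mapping.keys m \<subseteq> S \<and> c m \<in> K"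
    "y = (\<Sum>m\<in>M. c m * mon_eval m)"
  using assms by (auto simp: mpolys_def)

lemma mpolys_const: "is_subfield K \<Longrightarrow> x \<in> K \<Longrightarrow> x \<in> mpolys K S"
  using mpolys_family[of K "{()}" "\<lambda>_. 0" S "\<lambda>_. x"] by simp

lemma mpolys_var: "is_subfield K \<Longrightarrow> x \<in> S \<Longrightarrow> x \<in> mpolys K S"
  using mpolys_family[of K "{()}" "\<lambda>_. Poly_Mapping.single x 1" S "\<lambda>_. 1"]
  by (simp add: mon_eval_single is_subfieldD)

lemma mpolys_add:
  assumes K: "is_subfield K" and "y \<in> mpolys K S" "z \<in> mpolys K S"
  shows "y + z \<in> mpolys K S"
proof -
  obtain M c where y: "finite M" "\<forall>m\<in>M. Poly_Mapping.keys m \<subseteq> S \<and> c m \<in> K"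
    "y = (\<Sum>m\<in>M. c m * mon_eval m)" using assms(2) by (rule mpolysE)
  obtain N d where z: "finite N" "\<forall>m\<in>N. Poly_Mapping.keys m \<subseteq> S \<and> d m \<in> K"
    "z = (\<Sum>m\<in>N. d m * mon_eval m)" using assms(3) by (rule mpolysE)
  have "y + z = (\<Sum>i\<in>M <+> N. case_sum c d i * mon_eval (case_sum id id i))"
    using y(1) z(1) by (simp add: sum.Plus y(3) z(3))
  then show ?thesis
    using y z mpolys_family[OF K, of "M <+> N" "case_sum id id" S "case_sum c d"] by (simp; force)
qed

lemma mpolys_mult:
  assumes K: "is_subfield K" and "y \<in> mpolys K S" "z \<in> mpolys K S"
  shows "y * z \<in> mpolys K S"
proof -
  obtain M c where y: "finite M" "\<forall>m\<in>M. Poly_Mapping.keys m \<subseteq> S \<and> c m \<in> K"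
    "y = (\<Sum>m\<in>M. c m * mon_eval m)" using assms(2) by (rule mpolysE)
  obtain N d where z: "finite N" "\<forall>m\<in>N. Poly_Mapping.keys m \<subseteq> S \<and> d m \<in> K"
    "z = (\<Sum>m\<in>N. d m * mon_eval m)" using assms(3) by (rule mpolysE)
  have "y * z = (\<Sum>i\<in>M \<times> N. (c (fst i) * d (snd i)) * mon_eval (fst i + snd i))"
    by (simp add: y(3) z(3) sum_product sum.cartesian_product case_prod_unfold mon_eval_add mult_ac)
  also have "\<dots> \<in> mpolys K S"
    using y z by (intro mpolys_family[OF K]) (auto intro: is_subfieldD[OF K] dest!: subsetD[OF keys_add])
  finally show ?thesis .
qed

lemma gen_field_fraction:
  assumes K: "is_subfield K" and y: "y \<in> gen_field K S"
  shows "\<exists>f\<in>mpolys K S. \<exists>g\<in>mpolys K S. g \<noteq> 0 \<and> y = f / g"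
proof -
  let ?Q = "{y. \<exists>f\<in>mpolys K S. \<exists>g\<in>mpolys K S. g \<noteq> 0 \<and> y = f / g}"
  have Q: "z \<in> ?Q" if "f \<in> mpolys K S" "g \<in> mpolys K S" "g \<noteq> 0" "z = f / g" for f g z
    using that by blast
  note one = mpolys_const[OF K is_subfieldD(2)[OF K], of S]
  have neg: "- f \<in> mpolys K S" if "f \<in> mpolys K S" for f
    using mpolys_mult[OF K mpolys_const[OF K, of "-1"] that] is_subfieldD[OF K] by simp
  have "gen_field K S \<subseteq> ?Q"
  proof (intro gen_field_least is_subfieldI)
    have "mpolys K S \<subseteq> ?Q"
    proof
      fix z assume "z \<in> mpolys K S"
      then show "z \<in> ?Q"
        using one by (intro Q[of z 1]) auto
    qed
    then show "K \<subseteq> ?Q" "S \<subseteq> ?Q"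
      using mpolys_const[OF K] mpolys_var[OF K] by blast+
    then show "0 \<in> ?Q" "1 \<in> ?Q"
      using is_subfieldD(1,2)[OF K] by blast+
  next
    fix y z assume "y \<in> ?Q" "z \<in> ?Q"
    then obtain p q p' q' where *: "p \<in> mpolys K S" "q \<in> mpolys K S" "q \<noteq> 0" "y = p / q"
      "p' \<in> mpolys K S" "q' \<in> mpolys K S" "q' \<noteq> 0" "z = p' / q'" by auto
    show "y + z \<in> ?Q"
      using * by (intro Q[of "p * q' + p' * q" "q * q'"]) (auto intro!: mpolys_add[OF K] mpolys_mult[OF K] simp: add_frac_eq)
    show "y * z \<in> ?Q"
      using * by (intro Q[of "p * p'" "q * q'"]) (auto intro!: mpolys_mult[OF K])
  next
    fix y assume "y \<in> ?Q"
    then obtain p q where *: "p \<in> mpolys K S" "q \<in> mpolys K S" "q \<noteq> 0" "y = p / q"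
      by auto
    show "- y \<in> ?Q"
      using * by (intro Q[of "- p" q]) (auto intro!: neg)
    show "inverse y \<in> ?Q" if "y \<noteq> 0"
      using * that by (intro Q[of q p]) auto
  qed
  with y show ?thesis by auto
qed

lemma common_denominator:
  assumes K: "is_subfield K" and "finite A" "A \<subseteq> gen_field K S"
  shows "\<exists>g\<in>mpolys K S. g \<noteq> 0 \<and> (\<forall>y\<in>A. g * y \<in> mpolys K S)"
  using assms(2,3)
proof (induction A)
  case empty
  show ?case
    using mpolys_const[OF K is_subfieldD(2)[OF K], of S] by (auto intro!: bexI[of _ 1])
next
  case (insert y A)
  then obtain g where g: "g \<in> mpolys K S" "g \<noteq> 0" "\<forall>y\<in>A. g * y \<in> mpolys K S" by auto
  obtain p q where pq: "p \<in> mpolys K S" "q \<in> mpolys K S" "q \<noteq> 0" "y = p / q"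
    using gen_field_fraction[OF K, of y S] insert.prems by auto
  have "g * q * z \<in> mpolys K S" if "z \<in> insert y A" for z
  proof (cases "z = y")
    case True
    then show ?thesis using g pq mpolys_mult[OF K, of g S p] by simp
  next
    case False
    then have "q * (g * z) \<in> mpolys K S"
      using that g(3) pq(2) by (intro mpolys_mult[OF K, of q S "g * z"]) auto
    then show ?thesis by (simp add: mult_ac)
  qed
  then show ?case
    using g pq by (intro bexI[of _ "g * q"]) (auto intro!: mpolys_mult[OF K])
qed

text \<open>A univariate equation for x over K(S), cleared of denominators and with its coefficients
  expanded in monomials over S, is a multivariate relation over K. No terms can cancel because x is
  not in S.\<close>

lemma alg_indep_insert_imp_transc:
  assumes K: "is_subfield K" and ind: "alg_indep K (insert x S)" and x: "x \<notin> S"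
  shows "transc (gen_field K S) x"
  unfolding transc_def
proof (intro ballI impI)
  fix p assume p: "p \<in> polys (gen_field K S)" "poly p x = 0"
  obtain g where g: "g \<noteq> 0" "\<And>i. g * coeff p i \<in> mpolys K S"
  proof -
    have "set (coeffs p) \<subseteq> gen_field K S"
      using p(1) by (auto simp: polys_def coeffs_def)
    then obtain g where g: "g \<in> mpolys K S" "g \<noteq> 0" "\<forall>y\<in>set (coeffs p). g * y \<in> mpolys K S"
      using common_denominator[OF K, of "set (coeffs p)" S] by auto
    have "g * coeff p i \<in> mpolys K S" for i
      using g range_coeff[of p] mpolys_const[OF K is_subfieldD(1)[OF K], of S]
      by (metis insertE mult_zero_right rangeI)
    with g that show thesis by blast
  qed
  have "\<exists>M c. finite M \<and> (\<forall>m\<in>M. Poly_Mapping.keys m \<subseteq> S \<and> c m \<in> K) \<and> g * coeff p i = (\<Sum>m\<in>M. c m * mon_eval m)" for i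
    using mpolysE[OF g(2)[of i]] by metis
  then obtain M c where M: "\<And>i. finite (M i)" "\<And>i m. m \<in> M i \<Longrightarrow> Poly_Mapping.keys m \<subseteq> S \<and> c i m \<in> K"
    "\<And>i. g * coeff p i = (\<Sum>m\<in>M i. c i m * mon_eval m)" by metis
  let ?I = "SIGMA i:{..degree p}. M i"
  let ?\<mu> = "\<lambda>(i, m). Poly_Mapping.single x i + m"
  have lkx: "Poly_Mapping.lookup m x = 0" if "m \<in> M i" for m i
    using M(2)[OF that] x by (auto simp: in_keys_iff)
  have "0 = g * poly p x" by (simp add: p)
  also have "\<dots> = (\<Sum>i\<le>degree p. (g * coeff p i) * x ^ i)"
    by (simp add: poly_altdef sum_distrib_left mult_ac)
  also have "\<dots> = (\<Sum>i\<le>degree p. \<Sum>m\<in>M i. c i m * mon_eval (Poly_Mapping.single x i + m))"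
    unfolding M(3) sum_distrib_right mon_eval_add mon_eval_single by (intro sum.cong refl) (simp add: mult_ac)
  also have "\<dots> = (\<Sum>j\<in>?I. case_prod c j * mon_eval (?\<mu> j))"
    by (subst sum.Sigma) (auto simp: M(1) case_prod_unfold)
  finally have sum0: "(\<Sum>j\<in>?I. case_prod c j * mon_eval (?\<mu> j)) = 0" by simp
  \<comment> \<open>Monomials over S have x-exponent 0, so the x-exponent of the product recovers i
    and then m.\<close>
  have inj: "inj_on ?\<mu> ?I"
  proof (intro inj_onI, clarify)
    fix i m i' m'
    assume *: "m \<in> M i" "m' \<in> M i'" "Poly_Mapping.single x i + m = Poly_Mapping.single x i' + m'"
    have "i = i'"
      using arg_cong[OF *(3), of "\<lambda>m. Poly_Mapping.lookup m x"] lkx[OF *(1)] lkx[OF *(2)]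
      by (simp add: lookup_add)
    with * show "i = i' \<and> m = m'" by simp
  qed
  have "c i m = 0" if "i \<le> degree p" "m \<in> M i" for i m
  proof -
    have "case_prod c (i, m) = 0"
    proof (rule alg_indep_family[OF is_subfieldD(1)[OF K] ind _ inj _ _ sum0])
      show "finite ?I" by (auto simp: M(1))
      show "(i, m) \<in> ?I" using that by auto
    qed (use M(2) in \<open>auto dest!: subsetD[OF keys_add] split: if_splits\<close>)
    then show ?thesis by simp
  qed
  then have "g * coeff p i = 0" if "i \<le> degree p" for i
    unfolding M(3) using that by (intro sum.neutral) auto
  then have "coeff p (degree p) = 0"
    using g(1) by auto
  then show "p = 0" by simp
qed

text \<open>Collecting a relation by powers of x gives a univariate polynomial over K(S) with root
  x. It vanishes by transcendence, and each of its coefficients is a relation among the elements of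
  S alone.\<close>

lemma alg_indep_insertI:
  assumes K: "is_subfield K" and S: "alg_indep K S" and x: "transc (gen_field K S) x"
  shows "alg_indep K (insert x S)"
  unfolding alg_indep_iff_mon[OF is_subfieldD(1)[OF K]]
proof (intro conjI allI impI)
  show "finite (insert x S)" using S by (simp add: alg_indep_finite)
next
  fix M :: "('a \<Rightarrow>\<^sub>0 nat) set" and c :: "('a \<Rightarrow>\<^sub>0 nat) \<Rightarrow> 'a"
  assume M: "finite M" "\<forall>m\<in>M. Poly_Mapping.keys m \<subseteq> insert x S \<and> c m \<in> K" "(\<Sum>m\<in>M. c m * mon_eval m) = 0"
  \<comment> \<open>\<open>u m\<close> is m with the variable x removed, the cofactor of its power
    of x.\<close>
  define u where "u m = Poly_Mapping.update x 0 m" for m :: "'a \<Rightarrow>\<^sub>0 nat"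
  have split: "m = Poly_Mapping.single x (Poly_Mapping.lookup m x) + u m" for m
    by (rule poly_mapping_eqI) (auto simp: u_def lookup_add lookup_single lookup_update when_def)
  have mon_split: "mon_eval m = x ^ Poly_Mapping.lookup m x * mon_eval (u m)" for m
    using arg_cong[OF split, of mon_eval m] by (simp add: mon_eval_add mon_eval_single)
  have keys_u: "Poly_Mapping.keys (u m) \<subseteq> S" if "m \<in> M" for m
    using M(2) that by (auto simp: u_def keys_update)
  let ?e = "\<lambda>m. Poly_Mapping.lookup m x"
  have sub: "mon_eval m \<in> gen_field K S" if "Poly_Mapping.keys m \<subseteq> S" for m
    unfolding mon_eval_def using that gen_field_gens[of S K]
    by (auto intro!: is_subfield_prod is_subfield_power is_subfield_gen_field)
  define P where "P = (\<Sum>m\<in>M. monom (c m * mon_eval (u m)) (?e m))"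
  have P: "P \<in> polys (gen_field K S)"
    unfolding P_def using M(2) gen_field_base[of K S] sub[OF keys_u]
    by (auto intro!: polys_sum polys_closed is_subfieldD is_subfield_gen_field)
  have "poly P x = (\<Sum>m\<in>M. c m * mon_eval m)"
    unfolding P_def poly_sum poly_monom
  proof (intro sum.cong refl)
    fix m
    show "c m * mon_eval (u m) * x ^ ?e m = c m * mon_eval m"
      using mon_split[of m] by (simp add: mult_ac)
  qed
  then have "P = 0"
    using transcD[OF x P] M(3) by simp
  show "\<forall>m\<in>M. c m = 0"
  proof
    fix m assume m: "m \<in> M"
    \<comment> \<open>These are the terms contributing to the same power of x as m; with that
      exponent fixed, \<open>u\<close> loses no information and is injective.\<close>
    let ?I = "{n \<in> M. ?e n = ?e m}"
    have "0 = coeff P (?e m)" by (simp add: \<open>P = 0\<close>)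
    also have "\<dots> = (\<Sum>n\<in>M. if ?e n = ?e m then c n * mon_eval (u n) else 0)"
      by (simp add: P_def coeff_sum)
    also have "\<dots> = (\<Sum>n\<in>?I. c n * mon_eval (u n))"
      using M(1) by (simp add: sum.inter_filter)
    finally have sum0: "(\<Sum>n\<in>?I. c n * mon_eval (u n)) = 0" by simp
    have inj: "inj_on u ?I"
    proof (rule inj_onI)
      fix n n' assume "n \<in> ?I" "n' \<in> ?I" "u n = u n'"
      then show "n = n'" using split[of n] split[of n'] by simp
    qed
    show "c m = 0"
      by (rule alg_indep_family[OF is_subfieldD(1)[OF K] S _ inj _ _ sum0])
        (use M m keys_u in auto)
  qed
qed

section \<open>Transcendence degree\<close>

text \<open>The Steinitz exchange property. Otherwise y and then z could be adjoined as successive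
  transcendentals; independence of a set ignores the order, so y would be transcendental over
  K(z).\<close>

lemma acl_exchange:
  assumes K: "is_subfield K" and y: "y \<in> acl (gen_field K {z})" and "transc K y"
  shows "z \<in> acl (gen_field K {y})"
proof (rule ccontr)
  assume "z \<notin> acl (gen_field K {y})"
  then have z: "transc (gen_field K {y}) z" by (simp add: acl_def)
  have "alg_indep K {y}"
    using assms(3) by (intro alg_indep_insertI[OF K] alg_indep_empty) (simp_all add: gen_field_empty[OF K] is_subfieldD[OF K])
  then have "alg_indep K {z, y}"
    by (rule alg_indep_insertI[OF K _ z])
  moreover have "y \<noteq> z"
    using not_transc_self[OF is_subfield_gen_field] gen_field_gens[of "{y}" K] z by blast
  ultimately have "transc (gen_field K {z}) y"
    by (intro alg_indep_insert_imp_transc[OF K]) (simp_all add: insert_commute)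
  with y show False by (simp add: acl_def)
qed

lemma acl_least:
  assumes "is_subfield F" "E \<subseteq> acl F"
  shows "acl E \<subseteq> acl F"
  using acl_mono[OF assms(2)] acl_acl[OF assms(1)] by blast

text \<open>If p is transcendental, exchange makes z algebraic over K(p); then all that is algebraic
  over K(z), in particular q, is algebraic over K(p).\<close>

lemma not_alg_indep_pair:
  assumes K: "is_subfield K" and p: "p \<in> acl (gen_field K {z})" and q: "q \<in> acl (gen_field K {z})"
    and "p \<noteq> q"
  shows "\<not> alg_indep K {p, q}"
proof
  assume ind: "alg_indep K {p, q}"
  then have "transc K p"
    using alg_indep_insert_imp_transc[OF K alg_indep_subset[OF ind], of p "{}"]
    by (simp add: gen_field_empty[OF K])
  then have "z \<in> acl (gen_field K {p})"
    using acl_exchange[OF K p] by simp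
  moreover have "K \<subseteq> acl (gen_field K {p})"
    using gen_field_base acl_base[OF is_subfield_gen_field] by (rule order_trans)
  ultimately have "gen_field K {z} \<subseteq> acl (gen_field K {p})"
    by (intro gen_field_least is_subfield_acl is_subfield_gen_field) auto
  then have "q \<in> acl (gen_field K {p})"
    using q acl_least[OF is_subfield_gen_field] by blast
  moreover have "transc (gen_field K {p}) q"
    using ind \<open>p \<noteq> q\<close> by (intro alg_indep_insert_imp_transc[OF K]) (simp_all add: insert_commute)
  ultimately show False by (simp add: acl_def)
qed

text \<open>As \<open>trdeg\<close> is a supremum of cardinalities, it suffices to bound each
  independent set, and a larger one would contain an independent pair.\<close>

lemma trdeg_le_1:
  assumes K: "is_subfield K" and L: "L \<subseteq> acl (gen_field K {z})"
  shows "trdeg K L \<le> 1"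
  unfolding trdeg_def
proof (rule SUP_least)
  fix S assume S: "S \<in> {S. S \<subseteq> L \<and> alg_indep K S}"
  have "card S \<le> 1"
  proof (rule ccontr)
    assume "\<not> card S \<le> 1"
    then obtain p q where pq: "p \<in> S" "q \<in> S" "p \<noteq> q"
      using card_le_Suc0_iff_eq[of S] S alg_indep_finite[of K S] by auto
    then have "alg_indep K {p, q}"
      using S alg_indep_subset[of K S "{p, q}"] by auto
    with not_alg_indep_pair[OF K, of p z q] pq S L show False by auto
  qed
  then show "enat (card S) \<le> 1"
    by (simp add: one_enat_def)
qed

lemma trdeg_2_not_subset_acl:
  assumes K: "is_subfield K" and "trdeg K L = 2"
  shows "\<not> L \<subseteq> acl (gen_field K {z})"
proof
  assume "L \<subseteq> acl (gen_field K {z})"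
  from trdeg_le_1[OF K this] have "(2::enat) \<le> 1"
    by (simp only: assms(2))
  then show False
    by (simp add: numeral_eq_enat one_enat_def)
qed

text \<open>If x were algebraic over K, or y over K(x), the whole field would be algebraic over K(z)
  for a single z, against transcendence degree 2. This also excludes x = y.\<close>

lemma rational_over_two_generators:
  assumes K: "is_subfield K" and "trdeg K (gen_field K {x, y}) = 2"
  shows "rational_over K (gen_field K {x, y})"
proof -
  have no: "\<not> gen_field K {x, y} \<subseteq> acl (gen_field K {z})" for z
    by (rule trdeg_2_not_subset_acl[OF K assms(2)])
  have base: "K \<subseteq> acl (gen_field K {z})" "z \<in> acl (gen_field K {z})" for z
    using gen_field_base[of K "{z}"] gen_field_gens[of "{z}" K] acl_base[OF is_subfield_gen_field, of K "{z}"] by auto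
  have sf: "is_subfield (acl (gen_field K {z}))" for z
    by (intro is_subfield_acl is_subfield_gen_field)
  have x: "transc K x"
  proof (rule ccontr)
    assume "\<not> transc K x"
    then have "x \<in> acl (gen_field K {y})"
      using acl_mono[OF gen_field_base[of K "{y}"]] by (auto simp: acl_def)
    then show False
      using no[of y] gen_field_least[OF sf[of y], of K "{x, y}"] base by blast
  qed
  have y: "transc (gen_field K {x}) y"
  proof (rule ccontr)
    assume "\<not> transc (gen_field K {x}) y"
    then have "y \<in> acl (gen_field K {x})"
      by (simp add: acl_def)
    then show False
      using no[of x] gen_field_least[OF sf[of x], of K "{x, y}"] base by blast
  qed
  have "alg_indep K {x}"
    using x by (intro alg_indep_insertI[OF K] alg_indep_empty) (simp_all add: gen_field_empty[OF K] is_subfieldD[OF K])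
  then have "alg_indep K {x, y}"
    using alg_indep_insertI[OF K _ y] by (simp add: insert_commute)
  then show ?thesis
    using gen_field_gens unfolding rational_over_def by blast
qed

lemma sqrt_mem_acl:
  assumes F: "is_subfield F" and x: "x ^ 2 \<in> acl F"
  shows "x \<in> acl F"
proof -
  have "monom 1 2 - [:x ^ 2:] \<in> polys (acl F)"
    using x is_subfield_acl[OF F] by (intro polys_closed is_subfieldD)
  moreover have "coeff (monom 1 2 - [:x ^ 2:]) 2 = 1"
    by (simp add: coeff_pCons numeral_2_eq_2)
  then have "monom 1 2 - [:x ^ 2:] \<noteq> 0" by force
  moreover have "poly (monom 1 2 - [:x ^ 2:]) x = 0"
    by (simp add: poly_monom)
  ultimately have "x \<in> acl (acl F)"
    unfolding acl_def[of "acl F"] transc_def by blast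
  then show ?thesis using acl_acl[OF F] by blast
qed

text \<open>If t1 were in K, the two relations would make the squares of t2 and t4, hence t2 and t4
  themselves, algebraic over K(t3), leaving room for only one transcendental.\<close>

lemma transcendental_of_trdeg_2:
  assumes K: "is_subfield K" and ac: "a \<in> K" "b \<in> K" "c \<in> K" "d \<in> K" "a \<noteq> 0"
    and trdeg: "trdeg K (gen_field K {t1, t2, t3, t4}) = 2"
    and rel: "t1 ^ 2 - a * t2 ^ 2 = b" "t3 ^ 2 - a * t4 ^ 2 = 2 * c * t1 + d"
  shows "t1 \<notin> K"
proof
  assume t1: "t1 \<in> K"
  let ?F = "gen_field K {t3}"
  let ?A = "acl ?F"
  note F = is_subfield_gen_field[of K "{t3}"]
  note cl = is_subfield_closed[OF is_subfield_acl[OF F]]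
  have KA: "x \<in> ?A" if "x \<in> K" for x
    using that gen_field_base acl_base[OF F] by blast
  have t3: "t3 \<in> ?A"
    using gen_field_gens acl_base[OF F] by blast
  have "t2 ^ 2 = (t1 ^ 2 - b) / a" "t4 ^ 2 = (t3 ^ 2 - (2 * c * t1 + d)) / a"
    unfolding rel[symmetric] using ac(5) by simp_all
  then have "t2 ^ 2 \<in> ?A" "t4 ^ 2 \<in> ?A"
    using KA[OF t1] t3 ac(1-4)[THEN KA] by (simp_all only: cl)
  then have "t2 \<in> ?A" "t4 \<in> ?A"
    using sqrt_mem_acl[OF F] by blast+
  then have "gen_field K {t1, t2, t3, t4} \<subseteq> ?A"
    using t1 t3 KA by (intro gen_field_least is_subfield_acl F) auto
  then show False
    using trdeg_2_not_subset_acl[OF K trdeg] by blast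
qed

section \<open>Common values of a binary form and a norm form\<close>

text \<open>The forms <p, q> and <1, -a> share a non-zero value. In the application p = e' and q =
  -a e; allowing w in place of 1 makes the equation homogeneous, so that denominators can be
  cleared.\<close>

definition common_value :: "'a::field set \<Rightarrow> 'a \<Rightarrow> 'a \<Rightarrow> 'a \<Rightarrow> bool" where
  "common_value F p q a \<longleftrightarrow> (\<exists>w\<in>F. \<exists>s\<in>F. \<exists>u\<in>F. \<exists>v\<in>F.
     p * w ^ 2 + q * s ^ 2 + a * v ^ 2 = u ^ 2 \<and> p * w ^ 2 + q * s ^ 2 \<noteq> 0)"

lemma common_valueI:
  "w \<in> F \<Longrightarrow> s \<in> F \<Longrightarrow> u \<in> F \<Longrightarrow> v \<in> F \<Longrightarrow> p * w ^ 2 + q * s ^ 2 + a * v ^ 2 = u ^ 2 \<Longrightarrow>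
    p * w ^ 2 + q * s ^ 2 \<noteq> 0 \<Longrightarrow> common_value F p q a"
  unfolding common_value_def by blast

lemma common_value_mono: "common_value E p q a \<Longrightarrow> E \<subseteq> F \<Longrightarrow> common_value F p q a"
  unfolding common_value_def by blast

text \<open>Scaling a solution over F(x) by a common denominator gives polynomials in x. As x is
  transcendental, the equation is an identity of polynomials and may be evaluated at any c in F;
  infinitely many c leave one outside the roots of the common value.\<close>

lemma common_value_descent_step:
  assumes F: "is_subfield F" "infinite F" and pqa: "p \<in> F" "q \<in> F" "a \<in> F" and x: "transc F x"
    and cv: "common_value (gen_field F {x}) p q a"
  shows "common_value F p q a"
proof -
  obtain w s u v where mem: "w \<in> gen_field F {x}" "s \<in> gen_field F {x}" "u \<in> gen_field F {x}" "v \<in> gen_field F {x}"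
    and eq: "p * w ^ 2 + q * s ^ 2 + a * v ^ 2 = u ^ 2" "p * w ^ 2 + q * s ^ 2 \<noteq> 0"
    using cv unfolding common_value_def by blast
  obtain w1 w2 where w: "w1 \<in> polys F" "w2 \<in> polys F" "poly w2 x \<noteq> 0" "w = poly w1 x / poly w2 x"
    using gen_field_rational_function[OF F(1) mem(1)] by blast
  obtain s1 s2 where s: "s1 \<in> polys F" "s2 \<in> polys F" "poly s2 x \<noteq> 0" "s = poly s1 x / poly s2 x"
    using gen_field_rational_function[OF F(1) mem(2)] by blast
  obtain u1 u2 where u: "u1 \<in> polys F" "u2 \<in> polys F" "poly u2 x \<noteq> 0" "u = poly u1 x / poly u2 x"
    using gen_field_rational_function[OF F(1) mem(3)] by blast
  obtain v1 v2 where v: "v1 \<in> polys F" "v2 \<in> polys F" "poly v2 x \<noteq> 0" "v = poly v1 x / poly v2 x"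
    using gen_field_rational_function[OF F(1) mem(4)] by blast
  define g where "g = poly (w2 * s2 * u2 * v2) x"
  have g: "g \<noteq> 0" using w s u v by (simp add: g_def)
  define W S U V where WSUV: "W = w1 * (s2 * u2 * v2)" "S = s1 * (w2 * u2 * v2)"
    "U = u1 * (w2 * s2 * v2)" "V = v1 * (w2 * s2 * u2)"
  have polys: "W \<in> polys F" "S \<in> polys F" "U \<in> polys F" "V \<in> polys F"
    unfolding WSUV using w(1,2) s(1,2) u(1,2) v(1,2) by (auto intro!: polys_closed[OF F(1)])
  have W: "poly W x = g * w" and S: "poly S x = g * s" and U: "poly U x = g * u" and V: "poly V x = g * v"
    unfolding WSUV w(4) s(4) u(4) v(4) g_def using w(3) s(3) u(3) v(3) by simp_all
  \<comment> \<open>G is the common value as a polynomial; only its roots have to be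
    avoided.\<close>
  define G where "G = smult p (W ^ 2) + smult q (S ^ 2)"
  have Gx: "poly G x = g ^ 2 * (p * w ^ 2 + q * s ^ 2)"
    by (simp add: G_def W S power_mult_distrib algebra_simps)
  have "G + smult a (V ^ 2) - U ^ 2 = 0"
  proof (rule transcD[OF x])
    show "G + smult a (V ^ 2) - U ^ 2 \<in> polys F"
      unfolding G_def using polys pqa by (intro polys_closed[OF F(1)])
    have "poly (G + smult a (V ^ 2) - U ^ 2) x = g ^ 2 * (p * w ^ 2 + q * s ^ 2 + a * v ^ 2 - u ^ 2)"
      by (simp add: Gx U V power_mult_distrib algebra_simps)
    then show "poly (G + smult a (V ^ 2) - U ^ 2) x = 0" by (simp add: eq(1))
  qed
  then have id: "G + smult a (V ^ 2) = U ^ 2" by simp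
  have "G \<noteq> 0"
    using Gx g eq(2) by force
  then have "finite {c. poly G c = 0}" by (rule poly_roots_finite)
  then obtain c where c: "c \<in> F" "poly G c \<noteq> 0"
    using F(2) by (metis (mono_tags, lifting) finite_subset mem_Collect_eq subsetI)
  show ?thesis
  proof (rule common_valueI)
    show "p * poly W c ^ 2 + q * poly S c ^ 2 + a * poly V c ^ 2 = poly U c ^ 2"
      using arg_cong[OF id, of "\<lambda>P. poly P c"] by (simp add: G_def)
    show "p * poly W c ^ 2 + q * poly S c ^ 2 \<noteq> 0"
      using c(2) by (simp add: G_def)
  qed (use polys c(1) in \<open>auto intro: poly_in_subfield[OF F(1)]\<close>)
qed

lemma common_value_descent:
  assumes K: "is_subfield K" "infinite K" "p \<in> K" "q \<in> K" "a \<in> K"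
    and "rational_over K R" "common_value R p q a"
  shows "common_value K p q a"
proof -
  obtain S where S: "alg_indep K S" "R = gen_field K S"
    using assms(6) unfolding rational_over_def by blast
  have "common_value (gen_field K S) p q a \<Longrightarrow> common_value K p q a"
    using alg_indep_finite[OF S(1)] S(1)
  proof (induction S)
    case empty
    then show ?case by (simp add: gen_field_empty[OF K(1)])
  next
    case (insert x S)
    have "infinite (gen_field K S)"
      using K(2) gen_field_base finite_subset by blast
    then have "common_value (gen_field K S) p q a"
      using insert.prems(1) gen_field_base[of K S] K(3-5)
        alg_indep_insert_imp_transc[OF K(1) insert.prems(2) insert.hyps(2)]
      unfolding gen_field_insert[of K x S]
      by (intro common_value_descent_step[OF is_subfield_gen_field, of K S p q a x]) blast+
    then show ?case
      by (rule insert.IH) (rule alg_indep_subset[OF insert.prems(2)], blast)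
  qed
  then show ?thesis using assms(7) S(2) by simp
qed

text \<open>f is assumed additive and multiplicative on L only, because
  \<open>embedding_over\<close> says nothing about values outside the field.\<close>

lemma common_value_image_iff:
  assumes L: "is_subfield L" and pqa: "p \<in> L" "q \<in> L" "a \<in> L"
    and hom: "\<And>x y. x \<in> L \<Longrightarrow> y \<in> L \<Longrightarrow> f (x + y) = f x + f y \<and> f (x * y) = f x * f y"
    and inj: "inj_on f L"
  shows "common_value (f ` L) (f p) (f q) (f a) \<longleftrightarrow> common_value L p q a"
proof -
  note cl = is_subfield_closed[OF L]
  have f0: "f 0 = 0"
    using conjunct1[OF hom[OF cl(1) cl(1)]] by (simp only: add_0 add_cancel_right_right)
  have sq: "f x ^ 2 = f (x ^ 2)" if "x \<in> L" for x
    using hom[OF that that] by (simp add: power2_eq_square)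
  have e1: "f p * f w ^ 2 + f q * f s ^ 2 = f (p * w ^ 2 + q * s ^ 2)" if "w \<in> L" "s \<in> L" for w s
    using that pqa by (simp add: sq hom cl)
  have e2: "f p * f w ^ 2 + f q * f s ^ 2 + f a * f v ^ 2 = f (p * w ^ 2 + q * s ^ 2 + a * v ^ 2)"
    if "w \<in> L" "s \<in> L" "v \<in> L" for w s v
    using that pqa by (simp add: sq hom cl)
  have "(f p * f w ^ 2 + f q * f s ^ 2 + f a * f v ^ 2 = f u ^ 2 \<and> f p * f w ^ 2 + f q * f s ^ 2 \<noteq> 0) \<longleftrightarrow>
    (p * w ^ 2 + q * s ^ 2 + a * v ^ 2 = u ^ 2 \<and> p * w ^ 2 + q * s ^ 2 \<noteq> 0)"
    if m: "w \<in> L" "s \<in> L" "u \<in> L" "v \<in> L" for w s u v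
  proof -
    have "f x = f y \<longleftrightarrow> x = y" if "x \<in> L" "y \<in> L" for x y
      using inj that by (auto dest: inj_onD)
    moreover have "p * w ^ 2 + q * s ^ 2 + a * v ^ 2 \<in> L" "p * w ^ 2 + q * s ^ 2 \<in> L" "u ^ 2 \<in> L"
      using m pqa cl by simp_all
    ultimately show ?thesis
      unfolding e2[OF m(1,2,4)] unfolding e1[OF m(1,2)] sq[OF m(3)] using f0 cl(1) by (metis (no_types))
  qed
  moreover have "(\<exists>y\<in>f ` L. P y) \<longleftrightarrow> (\<exists>x\<in>L. P (f x))" for P
    by blast
  ultimately show ?thesis
    unfolding common_value_def by (simp only: cong: bex_cong)
qed

section \<open>Rational parametrisation of the quadric\<close>

text \<open>Multiplying by n0 and composing forms on both sides yields U^2 - a V^2 = A^2 + p q C^2.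
  In the coordinates (U : A : V : C) this quadric contains (1 : -1 : 0 : 0), and g1, g2 are the
  coordinates of the projection from that point. The rest of the proof inverts the projection and
  the two linear substitutions.\<close>

lemma quadric_two_generators_aux:
  fixes k :: "'a::field set"
  assumes k: "is_subfield k" and two: "(2::'a) \<noteq> 0" and pqa: "p \<in> k" "q \<in> k" "a \<in> k"
    and mem: "w0 \<in> k" "s0 \<in> k" "u0 \<in> k" "v0 \<in> k"
    and n0: "p * w0 ^ 2 + q * s0 ^ 2 = n0" "u0 ^ 2 - a * v0 ^ 2 = n0" "n0 \<noteq> 0"
    and rel: "p + q * s ^ 2 = u ^ 2 - a * v ^ 2"
    and A: "A = p * w0 + q * s0 * s" "A \<noteq> 0" and U: "U = u * u0 + a * v * v0" and M: "U + A \<noteq> 0"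
  shows "\<exists>g1 g2. gen_field k {s, u, v} = gen_field k {g1, g2}"
proof -
  define V C where "V = u * v0 + v * u0" and "C = s0 - s * w0"
  define g1 g2 h where "g1 = V / (U + A)" and "g2 = C / (U + A)" and "h = a * g1 ^ 2 + p * q * g2 ^ 2"
  have "U ^ 2 - a * V ^ 2 = (u ^ 2 - a * v ^ 2) * (u0 ^ 2 - a * v0 ^ 2)"
    unfolding U V_def by Groebner_Basis.algebra
  also have "\<dots> = (p + q * s ^ 2) * (p * w0 ^ 2 + q * s0 ^ 2)"
    by (simp add: rel n0)
  also have "\<dots> = A ^ 2 + p * q * C ^ 2"
    unfolding A(1) C_def by Groebner_Basis.algebra
  \<comment> \<open>Dividing the factored equation by (U + A)^2 shows that h is the ratio (U - A) /
    (U + A), so g1 and g2 determine U : A.\<close>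
  finally have "U - A = h * (U + A)"
    using M unfolding h_def g1_def g2_def power_divide by (simp add: field_simps) Groebner_Basis.algebra
  then have hM: "(1 + h) * (U + A) = 2 * U" "(1 - h) * (U + A) = 2 * A"
    by Groebner_Basis.algebra+
  then have h: "1 - h \<noteq> 0" using A(2) two by auto
  \<comment> \<open>\<kappa> is to be the ratio C / A: C is g2 times U + A, and U + A is 2 A / (1 -
    h).\<close>
  define \<kappa> where "\<kappa> = 2 * g2 / (1 - h)"
  have C: "C = \<kappa> * A"
  proof -
    have "2 * C = 2 * g2 * (U + A)" using M by (simp add: g2_def)
    then have "2 * C * (1 - h) = 2 * g2 * ((1 - h) * (U + A))" by Groebner_Basis.algebra
    then have "2 * (C * (1 - h)) = 2 * (2 * g2 * A)" unfolding hM by Groebner_Basis.algebra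
    then have "C * (1 - h) = 2 * g2 * A"
      using two by (simp only: mult_cancel_left) simp
    then show ?thesis using h by (simp add: \<kappa>_def field_simps)
  qed
  \<comment> \<open>A and C are affine in s. Eliminating s gives a relation that fixes the scale of
    A once C / A is known; eliminating the constant term recovers s.\<close>
  have "w0 * A + q * s0 * C = n0" "p * w0 * C - s0 * A = - n0 * s"
    unfolding A(1) C_def n0(1)[symmetric] by Groebner_Basis.algebra+
  then have An: "A * (w0 + q * s0 * \<kappa>) = n0" and sn: "s = (s0 * A - p * w0 * C) / n0"
    using n0(3) unfolding C by (simp_all add: field_simps)
  have An': "A = n0 / (w0 + q * s0 * \<kappa>)"
    using An n0(3) by (metis mult_zero_right nonzero_eq_divide_eq)
  have MA: "U + A = 2 * A / (1 - h)" using hM(2) h by (simp add: field_simps)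
  have VM: "V = g1 * (U + A)" using M by (simp add: g1_def)
  have UM: "U = (U + A) - A" by simp
  \<comment> \<open>U + V sqrt(a) is the product of u + v sqrt(a) and u0 + v0 sqrt(a); multiplying
    by the conjugate of the second factor, whose norm is n0, undoes this.\<close>
  have "n0 * u = u0 * U - a * v0 * V" "n0 * v = u0 * V - v0 * U"
    unfolding n0(2)[symmetric] U V_def by Groebner_Basis.algebra+
  then have uv: "u = (u0 * U - a * v0 * V) / n0" "v = (u0 * V - v0 * U) / n0"
    using n0(3) by (simp_all add: field_simps)
  have n0k: "n0 \<in> k" using n0(1) mem pqa by (auto intro: is_subfield_closed[OF k])
  have "gen_field k {s, u, v} = gen_field k {g1, g2}"
  proof
    let ?G = "gen_field k {g1, g2}"
    note cl = is_subfield_closed[OF is_subfield_gen_field[of k "{g1, g2}"]]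
    have kG: "x \<in> ?G" if "x \<in> k" for x using that gen_field_base by blast
    have g: "g1 \<in> ?G" "g2 \<in> ?G" using gen_field_gens[of "{g1, g2}" k] by auto
    note m = mem[THEN kG] pqa[THEN kG] n0k[THEN kG] g
    have hG: "h \<in> ?G" unfolding h_def using m by (intro cl)
    have \<kappa>: "\<kappa> \<in> ?G" unfolding \<kappa>_def using m hG by (intro cl)
    have AG: "A \<in> ?G" unfolding An' using m \<kappa> by (intro cl)
    have CG: "C \<in> ?G" unfolding C using AG \<kappa> by (intro cl)
    have MG: "U + A \<in> ?G" unfolding MA using AG hG by (intro cl)
    have UG: "U \<in> ?G" by (subst UM) (intro cl(7) MG AG)
    have VG: "V \<in> ?G" unfolding VM by (intro cl(4) MG g)
    have "s \<in> ?G" unfolding sn using m AG CG by (intro cl)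
    moreover have "u \<in> ?G" "v \<in> ?G" unfolding uv using m UG VG by (simp_all only: cl)
    ultimately show "gen_field k {s, u, v} \<subseteq> ?G"
      by (intro gen_field_least is_subfield_gen_field gen_field_base) auto
  next
    let ?G = "gen_field k {s, u, v}"
    note cl = is_subfield_closed[OF is_subfield_gen_field[of k "{s, u, v}"]]
    have kG: "x \<in> ?G" if "x \<in> k" for x using that gen_field_base by blast
    have g: "s \<in> ?G" "u \<in> ?G" "v \<in> ?G" using gen_field_gens[of "{s, u, v}" k] by auto
    note m = mem[THEN kG] pqa[THEN kG] g
    have "U \<in> ?G" "A \<in> ?G" "V \<in> ?G" "C \<in> ?G"
      unfolding U A(1) V_def C_def using m by (simp_all only: cl)
    then have "g1 \<in> ?G" "g2 \<in> ?G"
      unfolding g1_def g2_def by (simp_all only: cl)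
    then show "gen_field k {g1, g2} \<subseteq> ?G"
      by (intro gen_field_least is_subfield_gen_field gen_field_base) auto
  qed
  then show ?thesis by blast
qed

lemma quadric_two_generators:
  fixes k :: "'a::field set"
  assumes k: "is_subfield k" and two: "(2::'a) \<noteq> 0" and pqa: "p \<in> k" "q \<in> k" "a \<in> k"
    and cv: "common_value k p q a" and s: "s \<notin> k" and rel: "p + q * s ^ 2 = u ^ 2 - a * v ^ 2"
  shows "\<exists>g1 g2. gen_field k {s, u, v} = gen_field k {g1, g2}"
proof -
  obtain w0 s0 u0 v0 where mem: "w0 \<in> k" "s0 \<in> k" "u0 \<in> k" "v0 \<in> k"
    and eq: "p * w0 ^ 2 + q * s0 ^ 2 + a * v0 ^ 2 = u0 ^ 2" "p * w0 ^ 2 + q * s0 ^ 2 \<noteq> 0"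
    using cv unfolding common_value_def by blast
  define n0 where "n0 = p * w0 ^ 2 + q * s0 ^ 2"
  have n0: "p * w0 ^ 2 + q * s0 ^ 2 = n0" "n0 \<noteq> 0" "u0 ^ 2 - a * v0 ^ 2 = n0"
    using eq by (auto simp: n0_def algebra_simps)
  define A U where "A = p * w0 + q * s0 * s" and "U = u * u0 + a * v * v0"
  \<comment> \<open>A vanishing affine expression in s would put s into k unless both its
    coefficients were zero, and then n0 would be zero as well.\<close>
  have A: "A \<noteq> 0"
  proof
    assume A0: "A = 0"
    show False
    proof (cases "q * s0 = 0")
      case True
      then have "p * w0 = 0" using A0 unfolding A_def by (metis add.right_neutral mult_zero_left)
      with True have "n0 = 0" using n0(1) by (auto simp: power2_eq_square)
      with n0(2) show False by simp
    next
      case False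
      then have "s = - (p * w0) / (q * s0)"
        using A0 by (simp add: A_def field_simps) Groebner_Basis.algebra
      also have "\<dots> \<in> k" using mem pqa by (auto intro!: is_subfield_closed[OF k])
      finally show False using s by simp
    qed
  qed
  show ?thesis
  proof (cases "U + A = 0")
    case False
    show ?thesis
      by (rule quadric_two_generators_aux[OF k two pqa mem n0(1,3,2) rel A_def A U_def False])
  next
    case True
    \<comment> \<open>Negating u0 and v0 keeps n0 and A but changes the sign of U. The two
      denominators cannot both vanish, since their sum is 2 A.\<close>
    have "- U + A \<noteq> 0"
    proof
      assume "- U + A = 0"
      with True have "2 * A = 0" by Groebner_Basis.algebra
      with A two show False by simp
    qed
    moreover have "- U = u * (- u0) + a * v * (- v0)" by (simp add: U_def)
    ultimately show ?thesis
      using quadric_two_generators_aux[OF k two pqa mem(1,2) is_subfieldD(5)[OF k mem(3)]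
          is_subfieldD(5)[OF k mem(4)] n0(1) _ n0(2) rel A_def A] n0(3) by simp
  qed
qed

text \<open>The substitution is $u + v\sqrt a = (t_3 + t_4\sqrt a)(1 + s\sqrt a)$, where
  $s = t_2 / (t_1 + \beta)$ is the slope parameter of the conic $t_1^2 - a t_2^2 = \beta^2$.\<close>
lemma quadric_model:
  fixes k :: "'a::field set"
  assumes k: "is_subfield k" and two: "(2::'a) \<noteq> 0"
    and mem: "a \<in> k" "c \<in> k" "d \<in> k" "\<beta> \<in> k" and \<beta>: "\<beta> \<noteq> 0" and cd: "c \<noteq> 0 \<or> d \<noteq> 0"
    and rel: "t1 ^ 2 - a * t2 ^ 2 = \<beta> ^ 2" "t3 ^ 2 - a * t4 ^ 2 = 2 * c * t1 + d"
    and t1: "t1 \<notin> k"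
  obtains s u v where "gen_field k {t1, t2, t3, t4} = gen_field k {s, u, v}" "s \<notin> k"
    "(d + 2 * c * \<beta>) + (- a * (d - 2 * c * \<beta>)) * s ^ 2 = u ^ 2 - a * v ^ 2"
    "(d + 2 * c * \<beta>) + (- a * (d - 2 * c * \<beta>)) * s ^ 2 \<noteq> 0"
proof -
  have tb: "t1 + \<beta> \<noteq> 0"
    using t1 is_subfieldD(5)[OF k mem(4)] by (metis add_eq_0_iff2)
  define s where "s = t2 / (t1 + \<beta>)"
  define u v where "u = t3 + a * s * t4" and "v = t4 + s * t3"
  define D where "D = 1 - a * s ^ 2"
  have t2: "t2 = s * (t1 + \<beta>)" using tb by (simp add: s_def)
  \<comment> \<open>One factor t1 + \<beta> of t1^2 - \<beta>^2 = a s^2 (t1 + \<beta>)^2 cancels,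
    leaving a linear equation for t1 over k(s).\<close>
  have "D * (t1 + \<beta>) * (t1 + \<beta>) = 2 * \<beta> * (t1 + \<beta>)"
    using rel(1) unfolding D_def t2 by Groebner_Basis.algebra
  then have D1: "D * (t1 + \<beta>) = 2 * \<beta>" using tb by simp
  then have D: "D \<noteq> 0" using two \<beta> by auto
  have t1D: "t1 = \<beta> * (1 + a * s ^ 2) / D"
    using D D1 by (simp add: field_simps) (simp add: D_def algebra_simps)
  have s: "s \<notin> k"
  proof
    assume "s \<in> k"
    then have "t1 \<in> k"
      unfolding t1D D_def using mem k by (auto intro!: is_subfield_closed[OF k])
    with t1 show False by simp
  qed
  \<comment> \<open>Division by 1 + s sqrt(a), whose norm is D.\<close>
  have t34: "t3 = (u - a * s * v) / D" "t4 = (v - s * u) / D"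
    using D by (simp_all add: field_simps u_def v_def D_def power2_eq_square)
  have form: "(d + 2 * c * \<beta>) + (- a * (d - 2 * c * \<beta>)) * s ^ 2 = (2 * c * t1 + d) * D"
    using D1 unfolding D_def by Groebner_Basis.algebra
  also have "\<dots> = u ^ 2 - a * v ^ 2"
    unfolding rel(2)[symmetric] u_def v_def D_def by Groebner_Basis.algebra
  finally have rel': "(d + 2 * c * \<beta>) + (- a * (d - 2 * c * \<beta>)) * s ^ 2 = u ^ 2 - a * v ^ 2" .
  have "2 * c * t1 + d \<noteq> 0"
  proof
    assume *: "2 * c * t1 + d = 0"
    then have c: "c \<noteq> 0" using cd by auto
    then have "t1 = - d / (2 * c)" using * two by (simp add: field_simps eq_neg_iff_add_eq_0)
    also have "\<dots> \<in> k" using mem by (auto intro!: is_subfield_closed[OF k])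
    finally show False using t1 by simp
  qed
  then have nz: "(d + 2 * c * \<beta>) + (- a * (d - 2 * c * \<beta>)) * s ^ 2 \<noteq> 0"
    using D form by simp
  have "gen_field k {t1, t2, t3, t4} = gen_field k {s, u, v}"
  proof
    let ?G = "gen_field k {s, u, v}"
    note cl = is_subfield_closed[OF is_subfield_gen_field[of k "{s, u, v}"]]
    have kG: "x \<in> ?G" if "x \<in> k" for x using that gen_field_base by blast
    have g: "s \<in> ?G" "u \<in> ?G" "v \<in> ?G" using gen_field_gens[of "{s, u, v}" k] by auto
    note m = mem[THEN kG] g
    have DG: "D \<in> ?G" unfolding D_def using m by (intro cl)
    have t1G: "t1 \<in> ?G" unfolding t1D using m DG by (intro cl)
    have "t2 \<in> ?G" unfolding t2 using m t1G by (intro cl)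
    moreover have "t3 \<in> ?G" "t4 \<in> ?G" unfolding t34 using m DG by (simp_all only: cl)
    ultimately show "gen_field k {t1, t2, t3, t4} \<subseteq> ?G"
      using t1G by (intro gen_field_least is_subfield_gen_field gen_field_base) auto
  next
    let ?G = "gen_field k {t1, t2, t3, t4}"
    note cl = is_subfield_closed[OF is_subfield_gen_field[of k "{t1, t2, t3, t4}"]]
    have kG: "x \<in> ?G" if "x \<in> k" for x using that gen_field_base by blast
    have g: "t1 \<in> ?G" "t2 \<in> ?G" "t3 \<in> ?G" "t4 \<in> ?G"
      using gen_field_gens[of "{t1, t2, t3, t4}" k] by auto
    note m = mem[THEN kG] g
    have sG: "s \<in> ?G" unfolding s_def using m by (intro cl)
    have "u \<in> ?G" "v \<in> ?G" unfolding u_def v_def using m sG by (simp_all only: cl)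
    with sG show "gen_field k {s, u, v} \<subseteq> ?G"
      by (intro gen_field_least is_subfield_gen_field gen_field_base) auto
  qed
  then show thesis using that s rel' nz by blast
qed

section \<open>Hilbert symbols\<close>

lemma hilbert_trivialI_norm:
  fixes F :: "'a::field set"
  assumes F: "is_subfield F" and two: "(2::'a) \<noteq> 0" and a: "a \<in> F" "a \<noteq> 0"
    and xy: "x \<in> F" "y \<in> F" and e: "x ^ 2 - a * y ^ 2 = e" "e \<noteq> 0"
  shows "hilbert_trivial F a e"
proof (cases "x = 0")
  case False
  have "a * (y / x) ^ 2 + e * (1 / x) ^ 2 = 1"
    unfolding e(1)[symmetric] using False by (simp add: field_simps)
  then show ?thesis
    unfolding hilbert_trivial_def using xy by (meson is_subfield_divide[OF F] is_subfieldD(2)[OF F])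
next
  case True
  then have y: "y \<noteq> 0" using e by auto
  define i j l where "i = inverse (2::'a)" and "j = inverse a" and "l = inverse y"
  have mem: "(1 + j) * i \<in> F" "(1 - j) * i * l \<in> F"
    unfolding i_def j_def l_def using a(1) xy by (simp_all only: is_subfield_closed[OF F])
  have inv: "a * j = 1" "2 * i = 1" "y * l = 1"
    unfolding i_def j_def l_def by (rule right_inverse; fact)+
  \<comment> \<open>Now <a, e> is a hyperbolic plane and so represents 1; the witnesses come from
    ((1 + j)/2)^2 - ((1 - j)/2)^2 = j with j = 1/a.\<close>
  have "e = - a * y ^ 2" using e True by simp
  then have "a * ((1 + j) * i) ^ 2 + e * ((1 - j) * i * l) ^ 2 = (2 * i) ^ 2"
    using inv(1,3) by Groebner_Basis.algebra
  then have "a * ((1 + j) * i) ^ 2 + e * ((1 - j) * i * l) ^ 2 = 1"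
    by (simp only: inv(2) power_one)
  then show ?thesis
    unfolding hilbert_trivial_def using mem by blast
qed

lemma quadratic_extension_mem:
  assumes K: "is_subfield K" and r: "r ^ 2 \<in> K" "r \<notin> K" and y: "y \<in> gen_field K {r}"
  shows "\<exists>y1\<in>K. \<exists>y2\<in>K. y = y1 + y2 * r"
proof -
  note cl = is_subfield_closed[OF K]
  let ?E = "{y. \<exists>y1\<in>K. \<exists>y2\<in>K. y = y1 + y2 * r}"
  have E: "z \<in> ?E" if "y1 \<in> K" "y2 \<in> K" "z = y1 + y2 * r" for z y1 y2
    using that by blast
  have "gen_field K {r} \<subseteq> ?E"
  proof (intro gen_field_least is_subfieldI)
    show "K \<subseteq> ?E" using E[of _ 0] cl(1) by auto
    show "{r} \<subseteq> ?E" using E[of 0 1 r] cl(1,2) by auto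
    show "0 \<in> ?E" using E[of 0 0 0] cl(1) by auto
    show "1 \<in> ?E" using E[of 1 0 1] cl(1,2) by auto
  next
    fix y z assume "y \<in> ?E" "z \<in> ?E"
    then obtain y1 y2 z1 z2 where *: "y1 \<in> K" "y2 \<in> K" "y = y1 + y2 * r" "z1 \<in> K" "z2 \<in> K" "z = z1 + z2 * r"
      by auto
    show "y + z \<in> ?E"
    proof (rule E)
      show "y + z = (y1 + z1) + (y2 + z2) * r" using *(3,6) by Groebner_Basis.algebra
    qed (use * in \<open>simp_all only: cl\<close>)
    show "y * z \<in> ?E"
    proof (rule E)
      show "y * z = (y1 * z1 + y2 * z2 * r ^ 2) + (y1 * z2 + y2 * z1) * r"
        using *(3,6) by Groebner_Basis.algebra
    qed (use * r(1) in \<open>simp_all only: cl\<close>)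
  next
    fix y assume "y \<in> ?E"
    then obtain y1 y2 where *: "y1 \<in> K" "y2 \<in> K" "y = y1 + y2 * r" by auto
    show "- y \<in> ?E"
      using * by (intro E[of "- y1" "- y2"]) (auto intro: cl)
    assume y: "y \<noteq> 0"
    \<comment> \<open>The conjugate is the numerator of the inverse. If it vanished, either r would
      be a quotient of elements of K or y would be 0.\<close>
    have conj: "y1 - y2 * r \<noteq> 0"
    proof
      assume c: "y1 - y2 * r = 0"
      show False
      proof (cases "y2 = 0")
        case True
        with c y * show False by simp
      next
        case False
        then have "r = y1 / y2" using c by (simp add: field_simps)
        with * r(2) cl(8) show False by metis
      qed
    qed
    define N where "N = y1 ^ 2 - y2 ^ 2 * r ^ 2"
    have N: "y * (y1 - y2 * r) = N" unfolding N_def *(3) by Groebner_Basis.algebra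
    then have N0: "N \<noteq> 0" using y conj by auto
    have "N \<in> K" unfolding N_def using * r(1) by (auto intro!: cl)
    then have "y1 / N \<in> K" "- y2 / N \<in> K" using * by (auto intro!: cl)
    moreover have "inverse y = y1 / N + (- y2 / N) * r"
      using y N N0 by (simp add: field_simps)
    ultimately show "inverse y \<in> ?E" by (rule E)
  qed
  with y show ?thesis by auto
qed

lemma nonsquare_norm_nonzero:
  assumes K: "is_subfield K" and a: "\<not> (\<exists>x\<in>K. x ^ 2 = a)" and "u \<in> K" "v \<in> K" "u \<noteq> 0 \<or> v \<noteq> 0"
  shows "u ^ 2 - a * v ^ 2 \<noteq> 0"
proof
  assume *: "u ^ 2 - a * v ^ 2 = 0"
  then have v: "v \<noteq> 0" using assms(5) by auto
  then have "(u / v) ^ 2 = a" using * by (simp add: field_simps)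
  then show False using a assms(3,4) is_subfield_divide[OF K] by blast
qed

text \<open>When the symbol vanishes over K itself, w = 0 is enough: -a times a x^2 + e y^2 = 1
  rearranges to -a e y^2 + a = (a x)^2. Here y is non-zero because otherwise a x^2 = 1 would make a
  a square.\<close>

lemma common_value_of_hilbert_base:
  assumes K: "is_subfield K" and mem: "a \<in> K" "e \<in> K"
    and e: "e \<noteq> 0" and nonsq: "\<not> (\<exists>x\<in>K. x ^ 2 = a)" and hil: "hilbert_trivial K a e"
  shows "common_value K e' (- a * e) a"
proof -
  obtain x y where xy: "x \<in> K" "y \<in> K" "a * x ^ 2 + e * y ^ 2 = 1"
    using hil unfolding hilbert_trivial_def by blast
  have "1 ^ 2 - a * x ^ 2 \<noteq> 0"
    using nonsquare_norm_nonzero[OF K nonsq is_subfieldD(2)[OF K] xy(1)] by simp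
  then have y: "y \<noteq> 0" using xy(3) by auto
  have a: "a \<noteq> 0" using nonsq is_subfieldD(1)[OF K] by auto
  show ?thesis
  proof (rule common_valueI)
    have "- a * e * y ^ 2 + a = (a * x) ^ 2"
      using xy(3) by Groebner_Basis.algebra
    then show "e' * 0 ^ 2 + - a * e * y ^ 2 + a * 1 ^ 2 = (a * x) ^ 2"
      by simp
  qed (use xy mem e a y in \<open>auto intro: is_subfield_closed[OF K]\<close>)
qed

text \<open>A solution of $a x^2 + e y^2 = 1$ over $K(r)$ is $P + r Q$ for vectors $P, Q$ over $K$ with
  $\psi(P) + r^2 \psi(Q) = 0$ and $P, Q$ orthogonal, where $\psi = \langle 1, -a, -e \rangle$.
  Lagrange's identity $\psi(P) \psi(Q) - B(P, Q)^2 = \psi^{adj}(P \times Q)$ then expresses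
  $r^2 \psi(Q)^2$ by $\langle a, e, -ae \rangle$ over $K$.\<close>
lemma common_value_of_hilbert:
  fixes K :: "'a::field set"
  assumes K: "is_subfield K" and two: "(2::'a) \<noteq> 0" and mem: "a \<in> K" "e \<in> K" "e' \<in> K"
    and e: "e \<noteq> 0" and nonsq: "\<not> (\<exists>x\<in>K. x ^ 2 = a)" and r: "r ^ 2 = e * e'"
    and hil: "hilbert_trivial (gen_field K {r}) a e"
  shows "common_value K e' (- a * e) a"
proof (cases "r \<in> K")
  case True
  then have "gen_field K {r} = K"
    using gen_field_least[OF K, of K "{r}"] gen_field_base[of K "{r}"] by auto
  then show ?thesis
    using common_value_of_hilbert_base[OF K mem(1,2) e nonsq] hil by simp
next
  case False
  note cl = is_subfield_closed[OF K]
  have r2: "r ^ 2 \<in> K" using r mem cl by simp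
  have a: "a \<noteq> 0" using nonsq cl(1) by auto
  obtain x y where xy: "x \<in> gen_field K {r}" "y \<in> gen_field K {r}" "a * x ^ 2 + e * y ^ 2 = 1"
    using hil unfolding hilbert_trivial_def by blast
  obtain x1 x2 where x: "x1 \<in> K" "x2 \<in> K" "x = x1 + x2 * r"
    using quadratic_extension_mem[OF K r2 False xy(1)] by blast
  obtain y1 y2 where y: "y1 \<in> K" "y2 \<in> K" "y = y1 + y2 * r"
    using quadratic_extension_mem[OF K r2 False xy(2)] by blast
  \<comment> \<open>This \<open>P\<close> is a scalar, unlike the vector named above:
    \<open>P\<close> and \<open>2 * B\<close> are the coordinates of a x^2 + e y^2 - 1 with respect
    to 1 and r, so both vanish.\<close>
  define P where "P = a * (x1 ^ 2 + e * e' * x2 ^ 2) + e * (y1 ^ 2 + e * e' * y2 ^ 2) - 1"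
  define B where "B = a * x1 * x2 + e * y1 * y2"
  have PB: "P + 2 * B * r = 0"
    using xy(3) r unfolding x(3) y(3) P_def B_def by Groebner_Basis.algebra
  have PK: "P \<in> K" "2 * B \<in> K" unfolding P_def B_def using x y mem by (auto intro!: cl)
  have "2 * B = 0"
  proof (rule ccontr)
    assume nz: "2 * B \<noteq> 0"
    then have "r = - P / (2 * B)" using PB by (simp add: field_simps eq_neg_iff_add_eq_0)
    with PK cl(5,8) False show False by metis
  qed
  then have P0: "P = 0" and B0: "B = 0" using PB two by auto
  \<comment> \<open>Up to sign, v, y2 and x2 are the entries of the cross product of (1, x1, y1) and
    (0, x2, y2), and \<kappa> is -\<psi>(Q). Writing x2 as e f lets a factor e be cancelled from the
    identity.\<close>
  define v \<kappa> f where "v = x1 * y2 - x2 * y1" and "\<kappa> = a * x2 ^ 2 + e * y2 ^ 2" and "f = x2 / e"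
  have x2: "x2 = e * f" using e by (simp add: f_def)
  have "e * (e' * \<kappa> ^ 2 + - a * e * f ^ 2 + a * v ^ 2 - y2 ^ 2) = 0"
    using P0 B0 x2 unfolding P_def B_def v_def \<kappa>_def by Groebner_Basis.algebra
  then have eq: "e' * \<kappa> ^ 2 + - a * e * f ^ 2 + a * v ^ 2 = y2 ^ 2" using e by simp
  have mem': "v \<in> K" "\<kappa> \<in> K" "f \<in> K" unfolding v_def \<kappa>_def f_def using x y mem by (auto intro!: cl)
  \<comment> \<open>In the first case the common value is non-zero as a non-trivial norm. In the
    second the solution already lies in K.\<close>
  consider "y2 \<noteq> 0 \<or> v \<noteq> 0" | "y2 = 0" "x2 = 0" | "y2 = 0" "x2 \<noteq> 0" "v = 0" by blast
  then show ?thesis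
  proof cases
    case 1
    have "y2 ^ 2 - a * v ^ 2 \<noteq> 0"
      using 1 by (intro nonsquare_norm_nonzero[OF K nonsq y(2) mem'(1)])
    with eq have "e' * \<kappa> ^ 2 + - a * e * f ^ 2 \<noteq> 0"
      by (metis add_diff_cancel_right')
    then show ?thesis
      using eq mem' y(2) by (intro common_valueI[of \<kappa> K f y2 v])
  next
    case 2
    then have "hilbert_trivial K a e"
      unfolding hilbert_trivial_def using x(1) y(1) P0 unfolding P_def
      by (intro bexI[of _ x1] bexI[of _ y1]) (simp_all add: algebra_simps)
    then show ?thesis by (rule common_value_of_hilbert_base[OF K mem(1,2) e nonsq])
  next
    case 3
    then have y1: "y1 = 0" and x1: "x1 = 0" using B0 a by (auto simp: v_def B_def)
    \<comment> \<open>Hence the determinant of <e', -a e> is minus a square: the form is hyperbolic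
      and represents 1, which is also the norm of 1. The witnesses below are again halves of a sum
      and a difference.\<close>
    then have *: "a * e * e' * x2 ^ 2 = 1" using P0 3 by (simp add: P_def algebra_simps)
    then have e': "e' \<noteq> 0" by auto
    define i j where "i = inverse (2::'a)" and "j = inverse e'"
    have ij: "i \<in> K" "j \<in> K"
      unfolding i_def j_def using mem by (simp_all only: cl)
    show ?thesis
    proof (rule common_valueI)
      have inv: "e' * j = 1" "2 * i = 1"
        unfolding i_def j_def by (rule right_inverse; fact)+
      have "e' * ((1 + j) * i) ^ 2 + - a * e * ((1 - e') * x2 * i) ^ 2 = (2 * i) ^ 2"
        using * inv(1) by Groebner_Basis.algebra
      then have **: "e' * ((1 + j) * i) ^ 2 + - a * e * ((1 - e') * x2 * i) ^ 2 = 1"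
        by (simp only: inv(2) power_one)
      then show "e' * ((1 + j) * i) ^ 2 + - a * e * ((1 - e') * x2 * i) ^ 2 + a * 0 ^ 2 = 1 ^ 2"
        by simp
      show "e' * ((1 + j) * i) ^ 2 + - a * e * ((1 - e') * x2 * i) ^ 2 \<noteq> 0"
        unfolding ** by simp
    qed (use mem x ij in \<open>simp_all only: cl\<close>)
  qed
qed

text \<open>Over K(r), n e is the norm of r w + e s sqrt(a), and n is the norm of u + v sqrt(a).
  Hence e is the norm of the quotient, whose coordinates are the x and y of the proof.\<close>

lemma hilbert_of_common_value:
  fixes K :: "'a::field set"
  assumes K: "is_subfield K" and two: "(2::'a) \<noteq> 0" and mem: "a \<in> K" "e \<in> K"
    and ae: "a \<noteq> 0" "e \<noteq> 0" and r: "r ^ 2 = e * e'" and cv: "common_value K e' (- a * e) a"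
  shows "hilbert_trivial (gen_field K {r}) a e"
proof -
  let ?F = "gen_field K {r}"
  note F = is_subfield_gen_field[of K "{r}"]
  obtain w s u v where *: "w \<in> K" "s \<in> K" "u \<in> K" "v \<in> K"
    "e' * w ^ 2 + - a * e * s ^ 2 + a * v ^ 2 = u ^ 2" "e' * w ^ 2 + - a * e * s ^ 2 \<noteq> 0"
    using cv unfolding common_value_def by blast
  define n where "n = u ^ 2 - a * v ^ 2"
  have n': "n = e' * w ^ 2 + - a * e * s ^ 2"
    unfolding n_def *(5)[symmetric] by simp
  then have n0: "n \<noteq> 0" using *(6) by simp
  have n: "n * e = (r * w) ^ 2 - a * (e * s) ^ 2"
    using n' r by Groebner_Basis.algebra
  define x y where "x = (r * w * u - a * e * s * v) / n" and "y = (e * s * u - r * w * v) / n"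
  have "x * n = r * w * u - a * e * s * v" "y * n = e * s * u - r * w * v"
    using n0 by (simp_all add: x_def y_def)
  then have "n ^ 2 * (x ^ 2 - a * y ^ 2 - e) = 0"
    using n n_def by Groebner_Basis.algebra
  then have xy: "x ^ 2 - a * y ^ 2 = e"
    using n0 by simp
  have KF: "x \<in> ?F" if "x \<in> K" for x using that gen_field_base by blast
  have "r \<in> ?F" using gen_field_gens by blast
  then have "x \<in> ?F" "y \<in> ?F"
    unfolding x_def y_def n_def using *(1-4)[THEN KF] mem[THEN KF]
    by (simp_all only: is_subfield_closed[OF F])
  then show ?thesis
    using hilbert_trivialI_norm[OF F two KF[OF mem(1)] ae(1) _ _ xy ae(2)] by blast
qed

text \<open>Serves the degenerate case e = 0, where the coefficient -a e drops out and the condition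
  says that p is a norm up to a square.\<close>

lemma hilbert_trivial_iff_common_value:
  fixes k :: "'a::field set"
  assumes k: "is_subfield k" and two: "(2::'a) \<noteq> 0" and mem: "a \<in> k" "p \<in> k"
    and p: "p \<noteq> 0" and nonsq: "\<not> (\<exists>x\<in>k. x ^ 2 = a)"
  shows "hilbert_trivial k a p \<longleftrightarrow> common_value k p 0 a"
proof
  assume "hilbert_trivial k a p"
  then obtain x y where xy: "x \<in> k" "y \<in> k" "a * x ^ 2 + p * y ^ 2 = 1"
    unfolding hilbert_trivial_def by blast
  have "1 ^ 2 - a * x ^ 2 \<noteq> 0"
    using nonsquare_norm_nonzero[OF k nonsq is_subfieldD(2)[OF k] xy(1)] by simp
  then have "y \<noteq> 0" using xy(3) by auto
  then show "common_value k p 0 a"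
    using xy p by (intro common_valueI[of y k 0 1 x]) (auto simp: add.commute is_subfieldD[OF k])
next
  assume "common_value k p 0 a"
  then obtain w u v where *: "w \<in> k" "u \<in> k" "v \<in> k" "p * w ^ 2 + a * v ^ 2 = u ^ 2" "p * w ^ 2 \<noteq> 0"
    unfolding common_value_def by auto
  then have w: "w \<noteq> 0" by auto
  have "(u / w) ^ 2 - a * (v / w) ^ 2 = (u ^ 2 - a * v ^ 2) / w ^ 2"
    by (simp add: power_divide diff_divide_distrib)
  also have "\<dots> = p"
    unfolding *(4)[symmetric] using w by simp
  finally have "(u / w) ^ 2 - a * (v / w) ^ 2 = p" .
  moreover have "a \<noteq> 0" using nonsq is_subfieldD(1)[OF k] by auto
  ultimately show "hilbert_trivial k a p"
    using * p mem by (intro hilbert_trivialI_norm[OF k two]) (auto intro: is_subfield_divide[OF k])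
qed

section \<open>Transport along field embeddings\<close>

text \<open>Homomorphisms on the whole type, for \<open>rf_const\<close> and \<open>to_ac\<close>;
  the embeddings of \<open>L0\<close> in the definitions of rationality are homomorphisms on a
  subset only.\<close>

locale field_embedding =
  fixes h :: "'a::field \<Rightarrow> 'b::field"
  assumes add: "h (x + y) = h x + h y" and mult: "h (x * y) = h x * h y" and one: "h 1 = 1"
begin

lemma zero: "h 0 = 0"
  using add[of 0 0] by (simp only: add_0 add_cancel_right_right)

lemma uminus: "h (- x) = - h x"
  using add[of x "- x"] by (simp add: zero eq_neg_iff_add_eq_0 add.commute)

lemma inverse: "h (inverse x) = inverse (h x)"
proof (cases "x = 0")
  case False
  then have "h x * h (inverse x) = 1" by (simp flip: mult add: one)
  then show ?thesis by (metis inverse_unique)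
qed (simp add: zero)

lemma eq_0_iff: "h x = 0 \<longleftrightarrow> x = 0"
  using mult[of x "Fields.inverse x"] by (cases "x = 0") (auto simp: zero one)

lemma inj: "inj_on h A"
proof (rule inj_onI)
  fix x y assume "h x = h y"
  then have "h (x + - y) = 0" unfolding add uminus by simp
  then show "x = y" by (simp add: eq_0_iff)
qed

lemma is_subfield_image:
  assumes "is_subfield F"
  shows "is_subfield (h ` F)"
proof (rule is_subfieldI)
  show "0 \<in> h ` F" "1 \<in> h ` F"
    using zero one is_subfieldD(1,2)[OF assms] by force+
qed (use is_subfieldD[OF assms] in \<open>auto simp flip: add mult uminus inverse\<close>)

lemma is_subfield_vimage:
  assumes "is_subfield F"
  shows "is_subfield (h -` F)"
  using is_subfieldD[OF assms] by (intro is_subfieldI) (auto simp: zero one add mult uminus inverse)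

lemma gen_field_image: "h ` gen_field K S = gen_field (h ` K) (h ` S)"
proof
  have "gen_field K S \<subseteq> h -` gen_field (h ` K) (h ` S)"
    using gen_field_base[of "h ` K" "h ` S"] gen_field_gens[of "h ` S" "h ` K"]
    by (intro gen_field_least is_subfield_vimage is_subfield_gen_field) auto
  then show "h ` gen_field K S \<subseteq> gen_field (h ` K) (h ` S)" by blast
  show "gen_field (h ` K) (h ` S) \<subseteq> h ` gen_field K S"
    by (intro gen_field_least is_subfield_image is_subfield_gen_field image_mono gen_field_base gen_field_gens)
qed

lemma poly_map_poly: "poly (map_poly h p) (h x) = h (poly p x)"
  by (induction p) (simp_all add: map_poly_pCons zero add mult)

text \<open>A polynomial over the image is pulled back coefficientwise through an inverse of h on
  F.\<close>

lemma transc_image: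
  assumes F: "is_subfield F" and x: "transc F x"
  shows "transc (h ` F) (h x)"
  unfolding transc_def
proof (intro ballI impI)
  fix p assume p: "p \<in> polys (h ` F)" "poly p (h x) = 0"
  define g where "g = inv_into F h"
  have g0: "g 0 = 0"
    unfolding g_def using inv_into_f_f[OF inj is_subfieldD(1)[OF F]] by (simp add: zero)
  have hg: "h (g y) = y" "g y \<in> F" if "y \<in> h ` F" for y
    using that unfolding g_def by (auto simp: f_inv_into_f inv_into_into)
  define p' where "p' = map_poly g p"
  have cp: "coeff p i \<in> h ` F" for i
    using p(1) by (simp add: polys_def)
  have hp: "map_poly h p' = p"
    by (rule poly_eqI) (simp add: p'_def coeff_map_poly zero g0 hg(1)[OF cp])
  have "p' \<in> polys F"
    by (simp add: polys_def p'_def coeff_map_poly g0 hg(2)[OF cp])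
  moreover have "poly p' x = 0"
    using poly_map_poly[of p' x] p(2) unfolding hp by (simp add: eq_0_iff)
  ultimately have "p' = 0" by (rule transcD[OF x])
  then show "p = 0" using hp by simp
qed

text \<open>The variables of the polynomials are field elements, so their type changes with h.
  Adjoining one transcendental at a time needs only the univariate statement.\<close>

lemma alg_indep_image:
  assumes K: "is_subfield K" and S: "alg_indep K S"
  shows "alg_indep (h ` K) (h ` S)"
  using alg_indep_finite[OF S] S
proof (induction S)
  case empty
  show ?case
    using is_subfieldD(1)[OF is_subfield_image[OF K]] by (simp add: alg_indep_empty)
next
  case (insert x S)
  have "transc (gen_field (h ` K) (h ` S)) (h x)"
    using transc_image[OF is_subfield_gen_field alg_indep_insert_imp_transc[OF K insert.prems insert.hyps(2)]]
    by (simp only: gen_field_image)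
  moreover have "alg_indep K S"
    by (rule alg_indep_subset[OF insert.prems]) blast
  ultimately show ?case
    unfolding image_insert by (intro alg_indep_insertI[OF is_subfield_image[OF K]] insert.IH)
qed

lemma rational_over_image:
  assumes "is_subfield K" "rational_over K L"
  shows "rational_over (h ` K) (h ` L)"
proof -
  obtain S where S: "S \<subseteq> L" "alg_indep K S" "L = gen_field K S"
    using assms(2) unfolding rational_over_def by blast
  then show ?thesis
    unfolding rational_over_def S(3) gen_field_image
    by (intro exI[of _ "h ` S"] conjI gen_field_gens alg_indep_image[OF assms(1)]) simp_all
qed

lemma common_value_image:
  assumes "is_subfield K" "p \<in> K" "q \<in> K" "a \<in> K"
  shows "common_value (h ` K) (h p) (h q) (h a) \<longleftrightarrow> common_value K p q a"
  by (rule common_value_image_iff[OF assms _ inj]) (simp only: add mult)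

end

lemma field_embedding_rf_const: "field_embedding (rf_const :: 'a::field \<Rightarrow> 'a ratfun)"
proof
  fix x y :: 'a
  show "rf_const (x + y) = rf_const x + rf_const y"
    unfolding rf_const_def by (subst add_fract) (simp_all add: single_add)
  show "rf_const (x * y) = rf_const x * rf_const y"
    unfolding rf_const_def by (subst mult_fract) (simp add: mult_single)
  show "rf_const 1 = (1 :: 'a ratfun)"
    unfolding rf_const_def single_one by (rule One_fract_def[symmetric])
qed

lemma field_embedding_to_ac: "field_embedding (to_ac :: 'a::field \<Rightarrow> 'a alg_closure)"
  by unfold_locales simp_all

section \<open>The cycle of implications through the common-value condition\<close>

theorem theorem1p7:
  fixes k :: "'a::field set" and a b c d \<beta> t1 t2 t3 t4 :: 'a
  assumes k_field: "is_subfield k"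
    and k_inf: "infinite k"
    and char_ne_2: "(2::'a) \<noteq> 0"
    and not_ac: "\<not> alg_closed_subfield k"
    and abcd: "a \<in> k" "b \<in> k" "c \<in> k" "d \<in> k"
    and a_nonsq: "\<not> (\<exists>x\<in>k. x ^ 2 = a)"
    and b_ne: "b \<noteq> 0"
    and cd_ne: "c \<noteq> 0 \<or> d \<noteq> 0"
    and trdeg2: "trdeg k (gen_field k {t1, t2, t3, t4}) = 2"
    and rel1: "t1 ^ 2 - a * t2 ^ 2 = b"
    and rel2: "t3 ^ 2 - a * t4 ^ 2 = 2 * c * t1 + d"
    and beta: "\<beta> \<in> k" "\<beta> \<noteq> 0" "b = \<beta> ^ 2"
  defines "L0 \<equiv> gen_field k {t1, t2, t3, t4}"
  shows "(rational_over k L0 \<longleftrightarrow> stably_rational_over k L0)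
       \<and> (stably_rational_over k L0 \<longleftrightarrow> unirational_over k L0)
       \<and> (unirational_over k L0 \<longleftrightarrow>
           ((- 2 * c * \<beta> + d \<noteq> 0 \<and>
             hilbert_trivial (sqrt_ext (to_ac ` k) (to_ac (d ^ 2 - 4 * b * c ^ 2)))
                (to_ac a) (to_ac (- 2 * c * \<beta> + d)))
            \<or> (- 2 * c * \<beta> + d = 0 \<and> hilbert_trivial k a (2 * d))))"
proof -
  interpret rf: field_embedding "rf_const :: 'a \<Rightarrow> 'a ratfun"
    by (rule field_embedding_rf_const)
  interpret ac: field_embedding "to_ac :: 'a \<Rightarrow> 'a alg_closure"
    by (rule field_embedding_to_ac)
  note cl = is_subfield_closed[OF k_field]
  define e e' where "e = - 2 * c * \<beta> + d" and "e' = d + 2 * c * \<beta>"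
  have ek: "e \<in> k" "e' \<in> k" "- a * e \<in> k"
    unfolding e_def e'_def using abcd beta by (auto intro!: cl)
  have a: "a \<noteq> 0" using a_nonsq cl(1) by auto
  have L0: "is_subfield L0" "k \<subseteq> L0"
    unfolding L0_def by (rule is_subfield_gen_field, rule gen_field_base)
  have t1: "t1 \<notin> k"
    by (rule transcendental_of_trdeg_2[OF k_field abcd a trdeg2 rel1 rel2])
  have "d - 2 * c * \<beta> = e" by (simp add: e_def)
  then obtain s u v where suv: "L0 = gen_field k {s, u, v}" "s \<notin> k"
    "e' + - a * e * s ^ 2 = u ^ 2 - a * v ^ 2" "e' + - a * e * s ^ 2 \<noteq> 0"
    using quadric_model[OF k_field char_ne_2 abcd(1,3,4) beta(1,2) cd_ne rel1[unfolded beta(3)] rel2 t1]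
    unfolding L0_def e'_def by metis

  \<comment> \<open>No further variables are needed: the constants embedding is taken with the empty
    set.\<close>
  have i_ii: "stably_rational_over k L0" if "rational_over k L0"
    unfolding stably_rational_over_def
  proof (intro exI conjI)
    show "embedding_over rf_const k L0 rf_const"
      unfolding embedding_over_def by (simp add: rf.add rf.mult rf.one rf.inj)
    show "alg_indep (rf_const ` L0) {}"
      using rf.is_subfield_image[OF L0(1)] by (intro alg_indep_empty is_subfieldD(1))
    show "rational_over (rf_const ` k) (gen_field (rf_const ` L0) {})"
      using rf.rational_over_image[OF k_field that] by (simp only: gen_field_empty rf.is_subfield_image[OF L0(1)])
  qed

  \<comment> \<open>The field obtained by adjoining the extra variables is itself the rational field
    that receives \<open>L0\<close>.\<close>
  have ii_iii: "unirational_over k L0" if "stably_rational_over k L0"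
  proof -
    obtain f :: "'a \<Rightarrow> 'a ratfun" and S where f: "embedding_over rf_const k L0 f"
      "rational_over (rf_const ` k) (gen_field (f ` L0) S)"
      using \<open>stably_rational_over k L0\<close> unfolding stably_rational_over_def by blast
    have "rf_const ` k \<subseteq> f ` L0"
    proof
      fix y assume "y \<in> rf_const ` k"
      then obtain x where "x \<in> k" "y = f x" using f(1) unfolding embedding_over_def by auto
      then show "y \<in> f ` L0" using L0(2) by blast
    qed
    then show ?thesis
      unfolding unirational_over_def using f gen_field_base[of "f ` L0" S]
      by (intro exI[of _ f] exI[of _ "gen_field (f ` L0) S"] conjI is_subfield_gen_field) auto
  qed

  have iii_cv: "common_value k e' (- a * e) a" if "unirational_over k L0"
  proof -
    obtain f :: "'a \<Rightarrow> 'a ratfun" and R where f: "rational_over (rf_const ` k) R"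
      "embedding_over rf_const k L0 f" "f ` L0 \<subseteq> R"
      using \<open>unirational_over k L0\<close> unfolding unirational_over_def by blast
    have hom: "f (x + y) = f x + f y \<and> f (x * y) = f x * f y" if "x \<in> L0" "y \<in> L0" for x y
      using f(2) that unfolding embedding_over_def by blast
    have fk: "f x = rf_const x" if "x \<in> k" for x
      using f(2) that unfolding embedding_over_def by blast
    have inj: "inj_on f L0"
      using f(2) unfolding embedding_over_def by blast
    have "{s, u, v} \<subseteq> L0" unfolding suv(1) by (rule gen_field_gens)
    \<comment> \<open>The equation of the quadric is a common value over \<open>L0\<close> with w =
      1.\<close>
    then have "common_value L0 e' (- a * e) a"
      using suv(3,4) is_subfieldD(2)[OF L0(1)] by (intro common_valueI[of 1 L0 s u v]) simp_all
    then have "common_value (f ` L0) (f e') (f (- a * e)) (f a)"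
      using ek abcd(1) L0 by (subst common_value_image_iff[OF L0(1) _ _ _ hom inj]) auto
    then have "common_value R (rf_const e') (rf_const (- a * e)) (rf_const a)"
      using common_value_mono[OF _ f(3)] by (simp only: fk ek abcd)
    then have "common_value (rf_const ` k) (rf_const e') (rf_const (- a * e)) (rf_const a)"
      using k_inf ek abcd(1) finite_imageD[OF _ rf.inj]
      by (intro common_value_descent[OF rf.is_subfield_image[OF k_field] _ _ _ _ f(1)]) blast+
    then show ?thesis
      by (simp only: rf.common_value_image[OF k_field ek(2,3) abcd(1)])
  qed

  have cv_i: "rational_over k L0" if cv: "common_value k e' (- a * e) a"
  proof -
    obtain g1 g2 where g: "L0 = gen_field k {g1, g2}"
      using quadric_two_generators[OF k_field char_ne_2 ek(2,3) abcd(1) cv suv(2,3)] suv(1) by metis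
    show ?thesis
      unfolding g using trdeg2 unfolding L0_def[symmetric] g by (rule rational_over_two_generators[OF k_field])
  qed

  have cv_iv: "common_value k e' (- a * e) a \<longleftrightarrow>
    ((e \<noteq> 0 \<and> hilbert_trivial (sqrt_ext (to_ac ` k) (to_ac (d ^ 2 - 4 * b * c ^ 2))) (to_ac a) (to_ac e))
      \<or> (e = 0 \<and> hilbert_trivial k a (2 * d)))"
  proof (cases "e = 0")
    case True
    \<comment> \<open>This is where 2 d in (iv) comes from: e' becomes 2 d, and d = 0 would force c
      = 0 too.\<close>
    then have "d = 2 * c * \<beta>" unfolding e_def by (simp add: add_eq_0_iff)
    then have e': "e' = 2 * d" and "d \<noteq> 0"
      using cd_ne char_ne_2 beta(2) unfolding e'_def by auto
    have "2 * d \<in> k" "2 * d \<noteq> 0"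
      using abcd(4) \<open>d \<noteq> 0\<close> char_ne_2 by (auto intro!: cl)
    from hilbert_trivial_iff_common_value[OF k_field char_ne_2 abcd(1) this a_nonsq]
    show ?thesis using True e' by simp
  next
    case False
    \<comment> \<open>The same choice as in \<open>sqrt_ext\<close>; only its square, which factors
      as e e', matters below.\<close>
    define r where "r = (SOME r :: 'a alg_closure. r ^ 2 = to_ac (d ^ 2 - 4 * b * c ^ 2))"
    have "\<exists>r :: 'a alg_closure. r ^ 2 = to_ac (d ^ 2 - 4 * b * c ^ 2)"
      using nth_root_exists[of 2 "to_ac (d ^ 2 - 4 * b * c ^ 2)"] by auto
    then have "r ^ 2 = to_ac (d ^ 2 - 4 * b * c ^ 2)"
      unfolding r_def by (rule someI_ex)
    also have "d ^ 2 - 4 * b * c ^ 2 = e * e'"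
      unfolding e_def e'_def beta(3) by Groebner_Basis.algebra
    finally have r: "r ^ 2 = to_ac e * to_ac e'" by (simp only: ac.mult)
    have K: "is_subfield (to_ac ` k)" by (rule ac.is_subfield_image[OF k_field])
    have two: "(2 :: 'a alg_closure) \<noteq> 0"
      using char_ne_2 by (metis to_ac_numeral to_ac_eq_0_iff)
    have mem: "to_ac a \<in> to_ac ` k" "to_ac e \<in> to_ac ` k" "to_ac e' \<in> to_ac ` k"
      using abcd(1) ek by auto
    have nonsq: "\<not> (\<exists>x\<in>to_ac ` k. x ^ 2 = to_ac a)"
      using a_nonsq by (auto simp flip: to_ac_power)
    have nz: "to_ac a \<noteq> 0" "to_ac e \<noteq> 0" using a False by simp_all
    have "common_value k e' (- a * e) a \<longleftrightarrow>
      common_value (to_ac ` k) (to_ac e') (- to_ac a * to_ac e) (to_ac a)"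
      using ac.common_value_image[OF k_field ek(2,3) abcd(1)] by (simp only: to_ac_mult to_ac_minus)
    also have "\<dots> \<longleftrightarrow> hilbert_trivial (gen_field (to_ac ` k) {r}) (to_ac a) (to_ac e)"
      using common_value_of_hilbert[OF K two mem nz(2) nonsq r]
        hilbert_of_common_value[OF K two mem(1,2) nz r] by blast
    finally show ?thesis
      using False by (simp add: sqrt_ext_def r_def)
  qed

  show ?thesis
    using i_ii ii_iii iii_cv cv_i cv_iv unfolding e_def by blast
qed

end
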